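(* Let $G$ be a honeycomb, 4.8.8 or 4.6.12 lattice on a torus, large enough that every non-contractible cycle has length greater than $8$. Let $u$ be any vertex of $G$. Choose a defect edge $e=\{u,w\}$ at $u$ as follows: for the honeycomb lattice, any edge at $u$; for the 4.8.8 lattice, an edge at $u$ bordering a square and an octagon; for the 4.6.12 lattice, an edge at $u$ bordering a square and a hexagon. Let $G'$ be the output of the super-plaquette algorithm applied to $(G,e)$. Then $G'$ uses only connections of $G$, and $L(G')$ equals $7$ for the honeycomb lattice, $7$ for the 4.8.8 lattice and $6$ for the 4.6.12 lattice. Moreover, $L(G')\le L(H)$ for every lattice $H$ satisfying all of the following: - $H$ is a tri-valent, 3-face-colourable multigraph embedded on the same torus; - its vertex set is $V(G)\setminus\{u,w'\}$ for some neighbour $w'$ of $u$; - every edge of $H$ joins two vertices adjacent in $G$.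
   Context: A colour-code lattice is a finite multigraph, in which parallel edges are allowed but loops are not, cellularly embedded in a closed surface. It must be tri-valent, meaning every vertex has degree 3. It must also be 3-face-colourable: each face carries one of three colours (red, green, blue) such that any two faces sharing an edge have different colours. Every edge lies on the boundary of two faces of different colours and is assigned the third colour. A face is identified with its set of boundary edges. The super-plaquette algorithm takes as input a colour-code lattice $G$, a vertex $u$ and an edge $e=\{u,w\}$ of colour $D$. It proceeds as follows. 1. Let $S_1,S_2$ be the two faces containing $e$; these are the shrink faces. 2. Let the merge faces be all faces of colour $D$ that share an edge with $S_1$ or $S_2$. 3. For each shrink face $S$, of colour $P$, and each edge $f$ of colour $D$ on the boundary of $S$ that contains neither $u$ nor $w$, add a new edge $f'$ joining the same endpoints as $f$. Give $f'$ the colour $T\notin\{D,P\}$, and add a new face $\{f,f'\}$ of colour $P$. 4. Delete the shrink faces. 5. Add a new face of colour $D$ consisting of all new edges $f'$, together with all edges of merge faces that are not on a shrink face. 6. Delete the merge faces. 7. Delete $u$, $w$ and all edges lying on no face. The honeycomb, 4.8.8 and 4.6.12 lattices are the periodic (torus) versions of the uniform planar tilings by regular polygons with vertex configurations 6.6.6, 4.8.8 and 4.6.12, respectively. Each is tri-valent and 3-face-colourable. For a multigraph $H$ with $V(H)\subseteq V(G)$, define $L(H)$ as the number of unordered pairs $\{x,y\}$ of vertices that are adjacent in $G$ but are not adjacent in $H$. Pairs involving a vertex not in $H$ also count. This quantity is the number of removed connections. *)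

theory Defs
  imports Main
begin

section \<open>Colour-code lattices given by vertices, edges, end-points and faces (faces = edge sets)\<close>

datatype colour = Red | Green | Blue

record ('v, 'e) ccg =
  verts :: "'v set"
  edges :: "'e set"
  ends  :: "'e \<Rightarrow> 'v set"
  faces :: "'e set set"

definition faces_at :: "('v, 'e) ccg \<Rightarrow> 'e \<Rightarrow> 'e set set" where
  "faces_at G e = {S \<in> faces G. e \<in> S}"

text \<open>An edge gets the colour that is not the colour of either face containing it.\<close>
definition edge_colour :: "('v, 'e) ccg \<Rightarrow> ('e set \<Rightarrow> colour) \<Rightarrow> 'e \<Rightarrow> colour" where
  "edge_colour G col e = (THE c. c \<notin> col ` faces_at G e)"

text \<open>A proper 3-colouring of the faces: faces sharing an edge get different colours.\<close>
definition cc_colouring :: "('v, 'e) ccg \<Rightarrow> ('e set \<Rightarrow> colour) \<Rightarrow> bool" where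
  "cc_colouring G col \<longleftrightarrow>
     (\<forall>S1\<in>faces G. \<forall>S2\<in>faces G. S1 \<noteq> S2 \<and> S1 \<inter> S2 \<noteq> {} \<longrightarrow> col S1 \<noteq> col S2)"

text \<open>Adjacency (distinct vertices joined by an edge).\<close>
definition cc_adj :: "('v, 'e) ccg \<Rightarrow> 'v \<Rightarrow> 'v \<Rightarrow> bool" where
  "cc_adj G x y \<longleftrightarrow> x \<in> verts G \<and> y \<in> verts G \<and> x \<noteq> y \<and> (\<exists>e\<in>edges G. ends G e = {x, y})"

text \<open>Number of removed connections: unordered pairs adjacent in G but not adjacent in H
  (H given by its adjacency relation).\<close>
definition removed :: "('v, 'e) ccg \<Rightarrow> ('v \<Rightarrow> 'v \<Rightarrow> bool) \<Rightarrow> nat" where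
  "removed G adjH = card {{x, y} | x y. cc_adj G x y \<and> \<not> adjH x y}"

section \<open>The super-plaquette algorithm\<close>

text \<open>New edges f' are represented as Inr (S, f) (S the shrink face, f the copied edge);
  old edges as Inl f.  The output is the new lattice together with its face colouring.\<close>
definition super_plaquette ::
  "('v, 'e) ccg \<Rightarrow> ('e set \<Rightarrow> colour) \<Rightarrow> 'v \<Rightarrow> 'e \<Rightarrow>
     ('v, 'e + ('e set \<times> 'e)) ccg \<times> (('e + ('e set \<times> 'e)) set \<Rightarrow> colour)" where
  "super_plaquette G col u e =
    (let w  = (THE w. ends G e = {u, w});
         D  = edge_colour G col e;
         Sh = faces_at G e;
         M  = {F \<in> faces G. col F = D \<and> (\<exists>S\<in>Sh. F \<inter> S \<noteq> {})};
         NE = {(S, f). S \<in> Sh \<and> f \<in> S \<and> edge_colour G col f = D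
                        \<and> u \<notin> ends G f \<and> w \<notin> ends G f};
         small = {{Inl f, Inr (S, f)} | S f. (S, f) \<in> NE};
         big = Inr ` NE \<union> Inl ` (\<Union>M - \<Union>Sh);
         oldF = (\<lambda>F. Inl ` F) ` (faces G - Sh - M);
         F' = oldF \<union> small \<union> {big};
         E' = {x \<in> Inl ` edges G \<union> Inr ` NE. \<exists>F\<in>F'. x \<in> F};
         ends' = case_sum (ends G) (\<lambda>(S, f). ends G f);
         col' = (\<lambda>F. if F = big then D
                     else if F \<in> small then col (fst (SOME p. p \<in> NE \<and> F = {Inl (snd p), Inr p}))
                     else col (Inl -` F))
     in (\<lparr>verts = verts G - {u, w}, edges = E', ends = ends', faces = F'\<rparr>, col'))"

section \<open>The periodic lattices on a torus\<close>

type_synonym cell = "int \<times> int"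
type_synonym lvert = "cell \<times> nat"   \<comment> \<open>(unit cell, local vertex index)\<close>
type_synonym ledge = "cell \<times> nat"   \<comment> \<open>(unit cell, local edge index)\<close>

datatype tiling = Honeycomb | Tiling_488 | Tiling_4612

text \<open>Number of vertices per unit cell (primitive cell of the translation group).\<close>
fun nloc :: "tiling \<Rightarrow> nat" where
  "nloc Honeycomb = 2"
| "nloc Tiling_488 = 4"
| "nloc Tiling_4612 = 12"

text \<open>Edge types (k1, d, k2): the edge of type i in cell p joins (p, k1) and (p + d, k2).
  Coordinates are w.r.t. a basis of the translation lattice of the tiling.\<close>
fun etypes :: "tiling \<Rightarrow> (nat \<times> cell \<times> nat) list" where
  "etypes Honeycomb = [(0, (0, -1), 1), (0, (0, 0), 1), (0, (1, -1), 1)]"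
| "etypes Tiling_488 = [(0, (0, 0), 1), (0, (0, -1), 2), (0, (0, 0), 3), (1, (-1, 0), 3),
     (1, (0, 0), 2), (2, (0, 0), 3)]"
| "etypes Tiling_4612 = [(0, (0, 0), 1), (0, (0, 0), 11), (0, (1, 0), 5), (1, (0, 0), 2),
     (1, (0, 1), 8), (2, (0, 0), 3), (2, (0, 1), 7), (3, (0, 0), 4), (3, (-1, 1), 10),
     (4, (0, 0), 5), (4, (-1, 1), 9), (5, (0, 0), 6), (6, (-1, 0), 11), (6, (0, 0), 7),
     (7, (0, 0), 8), (8, (0, 0), 9), (9, (0, 0), 10), (10, (0, 0), 11)]"

text \<open>Face types: one representative of each translation class of faces, as a list of
  (cell offset, edge type).\<close>
fun ftypes :: "tiling \<Rightarrow> (cell \<times> nat) list list" where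
  "ftypes Honeycomb = [[((0, 0), 1), ((0, 0), 2), ((0, 1), 0), ((0, 1), 2), ((1, 0), 0), ((1, 0), 1)]]"
| "ftypes Tiling_488 =
    [[((-1, -1), 5), ((-1, 0), 1), ((-1, 0), 2), ((0, -1), 3), ((0, -1), 4), ((0, 0), 0),
      ((0, 0), 1), ((0, 0), 3)],
     [((0, 0), 0), ((0, 0), 2), ((0, 0), 4), ((0, 0), 5)]]"
| "ftypes Tiling_4612 =
    [[((0, 0), 1), ((0, 0), 2), ((1, 0), 11), ((1, 0), 12)],
     [((0, 0), 0), ((0, 0), 2), ((0, 0), 4), ((0, 1), 15), ((1, 0), 9), ((1, 0), 10)],
     [((0, 1), 16), ((1, 0), 7), ((1, 0), 8), ((1, 0), 10)],
     [((0, 1), 17), ((1, 0), 5), ((1, 0), 6), ((1, 0), 8), ((1, 1), 12), ((1, 1), 13)],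
     [((1, 0), 0), ((1, 0), 1), ((1, 0), 3), ((1, 0), 5), ((1, 0), 7), ((1, 0), 9), ((1, 0), 11),
      ((1, 0), 13), ((1, 0), 14), ((1, 0), 15), ((1, 0), 16), ((1, 0), 17)],
     [((1, 0), 3), ((1, 0), 4), ((1, 0), 6), ((1, 1), 14)]]"

definition cadd :: "cell \<Rightarrow> cell \<Rightarrow> cell" where
  "cadd p q = (fst p + fst q, snd p + snd q)"

text \<open>The torus is the plane modulo the sublattice
  Lambda = {(a*s + b*t, c*t)} (a > 0, c > 0; every full-rank sublattice of Z^2 has such a
  Hermite-normal-form basis).  red a b c p is the canonical representative of p mod Lambda.\<close>
definition red :: "int \<Rightarrow> int \<Rightarrow> int \<Rightarrow> cell \<Rightarrow> cell" where
  "red a b c p = (let t = snd p div c in ((fst p - b * t) mod a, snd p mod c))"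

definition cells :: "int \<Rightarrow> int \<Rightarrow> cell set" where
  "cells a c = {(i, j). 0 \<le> i \<and> i < a \<and> 0 \<le> j \<and> j < c}"

definition face_set :: "tiling \<Rightarrow> int \<Rightarrow> int \<Rightarrow> int \<Rightarrow> cell \<Rightarrow> nat \<Rightarrow> ledge set" where
  "face_set T a b c q j = (\<lambda>(off, i). (red a b c (cadd q off), i)) ` set (ftypes T ! j)"

definition torus_lattice :: "tiling \<Rightarrow> int \<Rightarrow> int \<Rightarrow> int \<Rightarrow> (lvert, ledge) ccg" where
  "torus_lattice T a b c =
    \<lparr>verts = {(q, k). q \<in> cells a c \<and> k < nloc T},
     edges = {(q, i). q \<in> cells a c \<and> i < length (etypes T)},
     ends  = (\<lambda>(q, i). case etypes T ! i of (k1, d, k2) \<Rightarrow> {(q, k1), (red a b c (cadd q d), k2)}),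
     faces = {face_set T a b c q j | q j. q \<in> cells a c \<and> j < length (ftypes T)}\<rparr>"

text \<open>The infinite planar tiling (universal cover) and the covering projection.\<close>
definition plane_ends :: "tiling \<Rightarrow> ledge \<Rightarrow> lvert set" where
  "plane_ends T x = (case x of (p, i) \<Rightarrow>
     (case etypes T ! i of (k1, d, k2) \<Rightarrow> {(p, k1), (cadd p d, k2)}))"

definition proj :: "int \<Rightarrow> int \<Rightarrow> int \<Rightarrow> cell \<times> nat \<Rightarrow> cell \<times> nat" where
  "proj a b c x = (red a b c (fst x), snd x)"

text \<open>A cycle: closed walk vs!0, es!0, vs!1, ..., vs!n = vs!0 with distinct vertices and edges;
  its length is the number of edges.\<close>
definition is_cycle :: "('v, 'e) ccg \<Rightarrow> 'v list \<Rightarrow> 'e list \<Rightarrow> bool" where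
  "is_cycle G vs es \<longleftrightarrow> es \<noteq> [] \<and> length vs = length es + 1 \<and> hd vs = last vs \<and>
     distinct (butlast vs) \<and> distinct es \<and> set es \<subseteq> edges G \<and> set vs \<subseteq> verts G \<and>
     (\<forall>i < length es. ends G (es ! i) = {vs ! i, vs ! Suc i})"

text \<open>A closed walk on the torus is contractible iff it lifts to a closed walk in the
  universal cover (the planar tiling).\<close>
definition contractible :: "tiling \<Rightarrow> int \<Rightarrow> int \<Rightarrow> int \<Rightarrow> lvert list \<Rightarrow> ledge list \<Rightarrow> bool" where
  "contractible T a b c vs es \<longleftrightarrow>
     (\<exists>ps qs. length ps = length vs \<and> length qs = length es \<and> hd ps = last ps \<and>
        (\<forall>i < length vs. proj a b c (ps ! i) = vs ! i) \<and>
        (\<forall>i < length es. proj a b c (qs ! i) = es ! i \<and>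
                         plane_ends T (qs ! i) = {ps ! i, ps ! Suc i}))"

section \<open>Tri-valent 3-face-colourable multigraphs cellularly embedded in the torus\<close>

text \<open>Oriented combinatorial maps (rotation systems): darts, the edge involution alpha,
  the vertex rotation sigma; vertices are sigma-orbits (labelled by vlabel),
  faces are orbits of sigma o alpha.\<close>
record ('d, 'v) cmap =
  darts  :: "'d set"
  alpha  :: "'d \<Rightarrow> 'd"
  sigma  :: "'d \<Rightarrow> 'd"
  vlabel :: "'d \<Rightarrow> 'v"

definition orb :: "('d \<Rightarrow> 'd) \<Rightarrow> 'd \<Rightarrow> 'd set" where
  "orb f x = {(f ^^ n) x | n. True}"

definition phi :: "('d, 'v) cmap \<Rightarrow> 'd \<Rightarrow> 'd" where
  "phi M = sigma M \<circ> alpha M"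

definition toroidal_cc_map :: "('d, 'v) cmap \<Rightarrow> bool" where
  "toroidal_cc_map M \<longleftrightarrow>
     finite (darts M) \<and> darts M \<noteq> {} \<and>
     (\<forall>d\<in>darts M. alpha M d \<in> darts M \<and> alpha M (alpha M d) = d \<and> alpha M d \<noteq> d) \<and>
     bij_betw (sigma M) (darts M) (darts M) \<and>
     \<comment> \<open>vertices are labelled injectively by their sigma-orbits\<close>
     (\<forall>d\<in>darts M. \<forall>d'\<in>darts M. vlabel M d = vlabel M d' \<longleftrightarrow> d' \<in> orb (sigma M) d) \<and>
     \<comment> \<open>no loops\<close>
     (\<forall>d\<in>darts M. vlabel M (alpha M d) \<noteq> vlabel M d) \<and>
     \<comment> \<open>tri-valent\<close>
     (\<forall>d\<in>darts M. card (orb (sigma M) d) = 3) \<and>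
     \<comment> \<open>connected\<close>
     (\<forall>d\<in>darts M. \<forall>d'\<in>darts M.
        (d, d') \<in> ({(x, alpha M x) | x. x \<in> darts M} \<union> {(x, sigma M x) | x. x \<in> darts M})\<^sup>*) \<and>
     \<comment> \<open>Euler characteristic 0 (orientable, so the surface is the torus)\<close>
     int (card (orb (sigma M) ` darts M)) - int (card (darts M) div 2)
       + int (card (orb (phi M) ` darts M)) = 0 \<and>
     \<comment> \<open>3-face-colourable\<close>
     (\<exists>col :: 'd set \<Rightarrow> colour. \<forall>d\<in>darts M.
        col (orb (phi M) d) \<noteq> col (orb (phi M) (alpha M d)))"

definition map_adj :: "('d, 'v) cmap \<Rightarrow> 'v \<Rightarrow> 'v \<Rightarrow> bool" where
  "map_adj M x y \<longleftrightarrow> (\<exists>d\<in>darts M. vlabel M d = x \<and> vlabel M (alpha M d) = y)"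

end

theory Submission
  imports Defs
begin

text \<open>
  Around a face the two remaining colours alternate on its edges, so the algorithm loses exactly the
  defect edge and half of the edges of each of the two shrink faces.

  Conversely, let \<open>H\<close> be a competing lattice. It is cubic, loopless and connected, so a vertex
  that lost a connection lost exactly one and carries exactly one double edge. Hence the double edges
  perfectly match the vertices that lost a connection. The four remaining neighbours of the
  deleted pair are among them, and matching these four up with at most one further lost connection
  forces short cycles that the three tilings do not have.

  All statements about short cycles are checked in the plane. They descend to the torus because two
  plane vertices at distance at most 8 that agree modulo the period lattice are equal.
\<close>

section \<open>The lattice produced by the algorithm\<close>

text \<open>The loss of the algorithm is exactly \<open>1 + (card S1 + card S2) / 2\<close>, with
  shrink faces of sizes 6, 6 or 4, 8 or 4, 6; hence 7, 7 and 6. A competitor always loses the five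
  connections at the deleted pair. If it lost no others, the four remaining neighbours would be
  matched among themselves, which in the absence of triangles needs two 4-cycles meeting only in the
  deleted edge. If it lost exactly one more, the ends of that connection would be matched to two of
  the four, which needs a 4-cycle and a 6-cycle through the deleted edge. A square-hexagon edge of
  4.6.12 is precisely this configuration, which is why the bound stops at 6 there.

  The obstacle is uniformity: the torus has arbitrary size, and the competitor may delete any
  neighbour of \<open>u\<close>. So the checks run over all vertex types and all edges at them, and
  use only a sufficient criterion for two positions to differ on the torus: different types, or a
  cell difference from a fixed list whose entries cannot be periods because of the hypothesis on
  cycles.\<close>

definition is_corner ::
  "('v, 'e) ccg \<Rightarrow> 'v \<Rightarrow> 'e \<Rightarrow> 'e \<Rightarrow> 'e \<Rightarrow> 'e set \<Rightarrow> 'e set \<Rightarrow> 'e set \<Rightarrow> bool" where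
  "is_corner G v e1 e2 e3 F12 F13 F23 \<longleftrightarrow>
     distinct [e1, e2, e3] \<and> distinct [F12, F13, F23] \<and>
     {f \<in> edges G. v \<in> ends G f} = {e1, e2, e3} \<and>
     faces_at G e1 = {F12, F13} \<and> faces_at G e2 = {F12, F23} \<and> faces_at G e3 = {F13, F23}"

text \<open>The cyclic order around faces is not recorded; the incidences at each vertex carry all
  the local information that the counting uses. Injectivity of \<open>ends\<close> makes counting
  edges the same as counting adjacent pairs.\<close>

locale cubic_cell_graph =
  fixes G :: "('v, 'e) ccg"
  assumes finite_edges: "finite (edges G)"
    and ends_edge: "f \<in> edges G \<Longrightarrow> \<exists>x\<in>verts G. \<exists>y\<in>verts G. x \<noteq> y \<and> ends G f = {x, y}"
    and inj_ends: "inj_on (ends G) (edges G)"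
    and face_edges: "S \<in> faces G \<Longrightarrow> S \<subseteq> edges G"
    and corner: "v \<in> verts G \<Longrightarrow>
      \<exists>e1 e2 e3 F12 F13 F23. is_corner G v e1 e2 e3 F12 F13 F23"

lemma edge_colour_eqI:
  assumes "faces_at G f = {F1, F2}" "col F1 \<noteq> col F2" "k \<noteq> col F1" "k \<noteq> col F2"
  shows "edge_colour G col f = k"
  unfolding edge_colour_def
proof (rule the_equality)
  show "k \<notin> col ` faces_at G f" using assms by auto
  fix k' assume "k' \<notin> col ` faces_at G f"
  then have "k' \<noteq> col F1" "k' \<noteq> col F2" using assms(1) by auto
  then show "k' = k" using assms(2-4)
    by (cases k; cases k'; cases "col F1"; cases "col F2") auto
qed

section \<open>Edge colours at a vertex and along a face\<close>

context cubic_cell_graph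
begin

lemma card_ends: "f \<in> edges G \<Longrightarrow> card (ends G f) = 2"
  using ends_edge[of f] by auto

lemma edge_end_exists: "f \<in> edges G \<Longrightarrow> \<exists>v\<in>verts G. v \<in> ends G f"
  using ends_edge[of f] by auto

lemma end_in_verts: "f \<in> edges G \<Longrightarrow> v \<in> ends G f \<Longrightarrow> v \<in> verts G"
  using ends_edge[of f] by auto

context
  fixes col assumes colouring: "cc_colouring G col"
begin

lemma col_neq:
  "S \<in> faces_at G f \<Longrightarrow> S' \<in> faces_at G f \<Longrightarrow> S \<noteq> S' \<Longrightarrow> col S \<noteq> col S'"
  using colouring unfolding cc_colouring_def faces_at_def by blast

text \<open>The three faces at a vertex meet pairwise along its edges, so they exhaust the colours,
  and each edge takes the colour of the face opposite to it.\<close>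

lemma corner_colours:
  assumes "is_corner G v e1 e2 e3 F12 F13 F23"
  shows "distinct [col F12, col F13, col F23]" "edge_colour G col e1 = col F23"
    "edge_colour G col e2 = col F13" "edge_colour G col e3 = col F12"
proof -
  have d: "distinct [F12, F13, F23]"
    and F: "faces_at G e1 = {F12, F13}" "faces_at G e2 = {F12, F23}" "faces_at G e3 = {F13, F23}"
    using assms unfolding is_corner_def by auto
  have c: "col F12 \<noteq> col F13" "col F12 \<noteq> col F23" "col F13 \<noteq> col F23"
    using d F col_neq[of F12 e1 F13] col_neq[of F12 e2 F23] col_neq[of F13 e3 F23] by auto
  then show "distinct [col F12, col F13, col F23]" by simp
  show "edge_colour G col e1 = col F23" "edge_colour G col e2 = col F13"
    "edge_colour G col e3 = col F12"
    using edge_colour_eqI[OF F(1) c(1), of "col F23"] edge_colour_eqI[OF F(2) c(2), of "col F13"]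
      edge_colour_eqI[OF F(3) c(3), of "col F12"] c by simp_all
qed

lemma faces_at_cases:
  assumes "f \<in> edges G"
  obtains F1 F2 where "faces_at G f = {F1, F2}" "F1 \<noteq> F2" "col F1 \<noteq> col F2"
    "edge_colour G col f \<noteq> col F1" "edge_colour G col f \<noteq> col F2"
proof -
  obtain v where v: "v \<in> verts G" "v \<in> ends G f" using edge_end_exists[OF assms] by blast
  then have f: "f \<in> {f \<in> edges G. v \<in> ends G f}" using assms by auto
  obtain e1 e2 e3 F12 F13 F23 where c: "is_corner G v e1 e2 e3 F12 F13 F23"
    using corner[OF v(1)] by blast
  have fe: "f \<in> {e1, e2, e3}" and d: "distinct [F12, F13, F23]"
    and F: "faces_at G e1 = {F12, F13}" "faces_at G e2 = {F12, F23}" "faces_at G e3 = {F13, F23}"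
    using c f unfolding is_corner_def by auto
  have cn: "col F12 \<noteq> col F13" "col F12 \<noteq> col F23" "col F13 \<noteq> col F23"
    using corner_colours(1)[OF c] by simp_all
  consider "f = e1" | "f = e2" | "f = e3" using fe by blast
  then show ?thesis
  proof cases
    case 1
    show ?thesis by (rule that[of F12 F13]) (use 1 d F corner_colours(2-4)[OF c] cn in simp_all)
  next
    case 2
    show ?thesis by (rule that[of F12 F23]) (use 2 d F corner_colours(2-4)[OF c] cn in simp_all)
  next
    case 3
    show ?thesis by (rule that[of F13 F23]) (use 3 d F corner_colours(2-4)[OF c] cn in simp_all)
  qed
qed

lemma edge_colour_neq_face: "S \<in> faces G \<Longrightarrow> f \<in> S \<Longrightarrow> edge_colour G col f \<noteq> col S"
proof -
  assume S: "S \<in> faces G" "f \<in> S"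
  then have "f \<in> edges G" using face_edges by blast
  then obtain F1 F2 where "faces_at G f = {F1, F2}"
    "edge_colour G col f \<noteq> col F1" "edge_colour G col f \<noteq> col F2"
    by (rule faces_at_cases)
  moreover have "S \<in> faces_at G f" using S by (simp add: faces_at_def)
  ultimately show ?thesis by auto
qed

lemma edge_colour_inj_at_vertex:
  assumes "v \<in> verts G" "f \<in> edges G" "g \<in> edges G" "v \<in> ends G f" "v \<in> ends G g"
    "edge_colour G col f = edge_colour G col g"
  shows "f = g"
proof -
  obtain e1 e2 e3 F12 F13 F23 where c: "is_corner G v e1 e2 e3 F12 F13 F23"
    using corner[OF assms(1)] by blast
  then have "f \<in> {e1, e2, e3}" "g \<in> {e1, e2, e3}" using assms unfolding is_corner_def by auto
  then show ?thesis using corner_colours[OF c] assms(6) by auto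
qed

text \<open>Two of the three edges at \<open>v\<close> lie on \<open>S\<close>, and they take the
  colours of the other two faces at \<open>v\<close>.\<close>

lemma ex_edge_of_colour_on_face:
  assumes S: "S \<in> faces G" "f \<in> S" "v \<in> ends G f" "k \<noteq> col S"
  shows "\<exists>g\<in>S. v \<in> ends G g \<and> edge_colour G col g = k"
proof -
  have f: "f \<in> edges G" using S face_edges by blast
  then have v: "v \<in> verts G" using S end_in_verts by blast
  obtain e1 e2 e3 F12 F13 F23 where cor: "is_corner G v e1 e2 e3 F12 F13 F23"
    using corner[OF v] by blast
  then have E: "{f \<in> edges G. v \<in> ends G f} = {e1, e2, e3}"
    and F: "faces_at G e1 = {F12, F13}" "faces_at G e2 = {F12, F23}" "faces_at G e3 = {F13, F23}"
    unfolding is_corner_def by auto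
  note c = corner_colours[OF cor]
  have mem: "e1 \<in> F12" "e1 \<in> F13" "e2 \<in> F12" "e2 \<in> F23" "e3 \<in> F13" "e3 \<in> F23"
    using F unfolding faces_at_def by auto
  have vs: "v \<in> ends G e1" "v \<in> ends G e2" "v \<in> ends G e3" using E by auto
  have "S \<in> faces_at G f" using S by (simp add: faces_at_def)
  moreover have "f \<in> {e1, e2, e3}" using E f S by auto
  ultimately have "S \<in> {F12, F13, F23}" using F by auto
  moreover have "k = col F12 \<or> k = col F13 \<or> k = col F23"
    using c(1) by (cases k; cases "col F12"; cases "col F13"; cases "col F23") auto
  ultimately show ?thesis using mem vs c(2-4) S(4) by auto
qed

text \<open>The edges of colour \<open>k\<close> on \<open>S\<close> form a perfect matching of the
  vertices of \<open>S\<close>: every vertex has one, and never two. This yields alternation without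
  any cyclic order on the boundary.\<close>

lemma card_face_vertices:
  assumes S: "S \<in> faces G" and k: "k \<noteq> col S"
  shows "2 * card {g \<in> S. edge_colour G col g = k} = card (\<Union>(ends G ` S))"
proof -
  let ?A = "{g \<in> S. edge_colour G col g = k}"
  have sub: "S \<subseteq> edges G" using S face_edges by blast
  have fin: "finite ?A" using finite_subset[OF sub finite_edges] by auto
  have "(\<Union>(ends G ` S)) = (\<Union>g\<in>?A. ends G g)"
    using ex_edge_of_colour_on_face[OF S _ _ k] by fastforce
  moreover have "card (\<Union>g\<in>?A. ends G g) = (\<Sum>g\<in>?A. card (ends G g))"
  proof (rule card_UN_disjoint[OF fin])
    show "\<forall>g\<in>?A. finite (ends G g)"
      using sub card_ends by (metis (no_types, lifting) card.infinite mem_Collect_eq subsetD zero_neq_numeral)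
    show "\<forall>g\<in>?A. \<forall>h\<in>?A. g \<noteq> h \<longrightarrow> ends G g \<inter> ends G h = {}"
    proof (intro ballI impI equals0I)
      fix g h v assume "g \<in> ?A" "h \<in> ?A" "g \<noteq> h" "v \<in> ends G g \<inter> ends G h"
      then show False
        using edge_colour_inj_at_vertex[of v g h] end_in_verts[of g v] sub by auto
    qed
  qed
  moreover have "(\<Sum>g\<in>?A. card (ends G g)) = (\<Sum>g\<in>?A. 2)"
    using sub card_ends by (intro sum.cong) auto
  ultimately show ?thesis by simp
qed

text \<open>Along a face the two other colours alternate, so each is carried by half of its edges.\<close>

lemma card_face_other_colour:
  assumes S: "S \<in> faces G" and k: "k \<noteq> col S"
  shows "2 * card {g \<in> S. edge_colour G col g \<noteq> k} = card S"
proof -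
  obtain k' where k': "k' \<noteq> k" "k' \<noteq> col S"
    by (cases k; cases "col S") (use k in auto)
  have fin: "finite S" using finite_subset[OF face_edges[OF S] finite_edges] .
  have "edge_colour G col g \<noteq> k \<longleftrightarrow> edge_colour G col g = k'" if "g \<in> S" for g
    using edge_colour_neq_face[OF S that] k k'
    by (cases k; cases k'; cases "col S"; cases "edge_colour G col g") auto
  then have eq: "{g \<in> S. edge_colour G col g \<noteq> k} = {g \<in> S. edge_colour G col g = k'}" by auto
  have "S = {g \<in> S. edge_colour G col g = k} \<union> {g \<in> S. edge_colour G col g \<noteq> k}" by auto
  then have "card S = card {g \<in> S. edge_colour G col g = k} + card {g \<in> S. edge_colour G col g \<noteq> k}"
    using card_Un_disjoint[of "{g \<in> S. edge_colour G col g = k}" "{g \<in> S. edge_colour G col g \<noteq> k}"] fin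
    by auto
  then show ?thesis using card_face_vertices[OF S k] card_face_vertices[OF S k'(2)] eq by simp
qed

end

end

section \<open>The connections that the algorithm deletes\<close>

locale super_plaquette_input = cubic_cell_graph G for G :: "('v, 'e) ccg" +
  fixes col u w e
  assumes colouring: "cc_colouring G col"
    and e: "e \<in> edges G" "ends G e = {u, w}"
begin

text \<open>Closed form for the old edges that end up on no face. The edge \<open>e\<close> is
  inserted separately because it has the defect colour itself.\<close>

definition lost_edges :: "'e set" where
  "lost_edges = insert e {f \<in> \<Union>(faces_at G e). edge_colour G col f \<noteq> edge_colour G col e}"

definition copied_edges :: "('e set \<times> 'e) set" where
  "copied_edges = {(S, f). S \<in> faces_at G e \<and> f \<in> S \<and> edge_colour G col f = edge_colour G col e
                        \<and> u \<notin> ends G f \<and> w \<notin> ends G f}"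

definition merge_faces :: "'e set set" where
  "merge_faces = {F \<in> faces G. col F = edge_colour G col e \<and> (\<exists>S\<in>faces_at G e. F \<inter> S \<noteq> {})}"

definition result_faces :: "('e + ('e set \<times> 'e)) set set" where
  "result_faces = (\<lambda>F. Inl ` F) ` (faces G - faces_at G e - merge_faces) \<union>
     {{Inl f, Inr (S, f)} | S f. (S, f) \<in> copied_edges} \<union>
     {Inr ` copied_edges \<union> Inl ` (\<Union>merge_faces - \<Union>(faces_at G e))}"

abbreviation result :: "('v, 'e + ('e set \<times> 'e)) ccg" where
  "result \<equiv> fst (super_plaquette G col u e)"

lemma uw: "u \<in> verts G" "w \<in> verts G" "u \<noteq> w"
proof -
  obtain x y where "x \<in> verts G" "y \<in> verts G" "x \<noteq> y" "ends G e = {x, y}"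
    using ends_edge[OF e(1)] by blast
  then show "u \<in> verts G" "w \<in> verts G" "u \<noteq> w" using e(2) by (auto simp: doubleton_eq_iff)
qed

lemma result_eq:
  "result = \<lparr>verts = verts G - {u, w},
     edges = {x \<in> Inl ` edges G \<union> Inr ` copied_edges. \<exists>F\<in>result_faces. x \<in> F},
     ends = case_sum (ends G) (\<lambda>(S, f). ends G f), faces = result_faces\<rparr>"
proof -
  have "(THE w. ends G e = {u, w}) = w"
    using e(2) by (intro the_equality) (auto simp: doubleton_eq_iff)
  then show ?thesis
    unfolding super_plaquette_def copied_edges_def merge_faces_def result_faces_def
    by (simp add: Let_def)
qed

text \<open>Any two edges at a vertex share a face, so every edge at an end of \<open>e\<close> lies
  on a face of \<open>e\<close>.\<close>

lemma edges_at_defect: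
  assumes "f \<in> edges G" "v \<in> ends G f" "v \<in> {u, w}"
  shows "f \<in> \<Union>(faces_at G e)"
proof -
  have v: "v \<in> verts G" using assms(3) uw by auto
  obtain e1 e2 e3 F12 F13 F23 where "is_corner G v e1 e2 e3 F12 F13 F23"
    using corner[OF v] by blast
  then have E: "{f \<in> edges G. v \<in> ends G f} = {e1, e2, e3}"
    and F: "faces_at G e1 = {F12, F13}" "faces_at G e2 = {F12, F23}" "faces_at G e3 = {F13, F23}"
    unfolding is_corner_def by auto
  have "e1 \<in> F12" "e1 \<in> F13" "e2 \<in> F12" "e2 \<in> F23" "e3 \<in> F13" "e3 \<in> F23"
    using F unfolding faces_at_def by auto
  moreover have "f \<in> {e1, e2, e3}" "e \<in> {e1, e2, e3}" using E assms e by auto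
  ultimately show ?thesis using F by auto
qed

text \<open>Edges at one vertex have different colours, so next to \<open>e\<close> no other edge
  has the defect colour.\<close>

lemma lost_edges_at_defect:
  assumes "f \<in> edges G" "v \<in> ends G f" "v \<in> {u, w}"
  shows "f \<in> lost_edges"
proof -
  have "v \<in> ends G e" "v \<in> verts G" using assms(3) e uw by auto
  then have "f = e" if "edge_colour G col f = edge_colour G col e"
    using edge_colour_inj_at_vertex[OF colouring] assms e that by blast
  then show ?thesis using edges_at_defect[OF assms] unfolding lost_edges_def by auto
qed

lemma lost_edges_subset: "lost_edges \<subseteq> edges G"
  using e face_edges unfolding lost_edges_def faces_at_def by auto

text \<open>A shrink-face edge of the defect colour away from \<open>u\<close> and \<open>w\<close>
  survives in its digon; an edge off the shrink faces survives in an untouched face or in the big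
  face. A lost edge other than \<open>e\<close> has a shrink face on one side and a merge face on
  the other, and the big face takes nothing from shrink faces.\<close>

lemma Inl_in_result_faces_iff:
  assumes f: "f \<in> edges G"
  shows "(\<exists>F\<in>result_faces. Inl f \<in> F) \<longleftrightarrow> f \<notin> lost_edges"
proof
  assume L: "f \<notin> lost_edges"
  show "\<exists>F\<in>result_faces. Inl f \<in> F"
  proof (cases "f \<in> \<Union>(faces_at G e)")
    case True
    then obtain S where "S \<in> faces_at G e" "f \<in> S" by blast
    moreover have "edge_colour G col f = edge_colour G col e"
      using True L unfolding lost_edges_def by auto
    moreover have "u \<notin> ends G f" "w \<notin> ends G f" using L lost_edges_at_defect f by auto
    ultimately have "(S, f) \<in> copied_edges" unfolding copied_edges_def by auto
    then have "{Inl f, Inr (S, f)} \<in> result_faces" unfolding result_faces_def by blast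
    then show ?thesis by blast
  next
    case False
    obtain F1 F2 where "faces_at G f = {F1, F2}"
      using faces_at_cases[OF colouring f] by metis
    then have F1: "F1 \<in> faces G" "f \<in> F1" unfolding faces_at_def by auto
    show ?thesis
    proof (cases "F1 \<in> merge_faces")
      case True
      then show ?thesis using F1 False unfolding result_faces_def by blast
    next
      case no: False
      have "F1 \<notin> faces_at G e" using False F1 by blast
      then have "Inl ` F1 \<in> result_faces" using no F1 unfolding result_faces_def by blast
      then show ?thesis using F1 by blast
    qed
  qed
next
  assume "\<exists>F\<in>result_faces. Inl f \<in> F"
  then consider (old) F where "F \<in> faces G - faces_at G e - merge_faces" "f \<in> F"
    | (copy) S where "(S, f) \<in> copied_edges" | (big) "f \<notin> \<Union>(faces_at G e)"
    unfolding result_faces_def by auto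
  then show "f \<notin> lost_edges"
  proof cases
    case old
    show ?thesis
    proof
      assume "f \<in> lost_edges"
      moreover have "f \<noteq> e" using old unfolding faces_at_def by auto
      ultimately obtain S where S: "S \<in> faces_at G e" "f \<in> S"
        and ce: "edge_colour G col f \<noteq> edge_colour G col e"
        unfolding lost_edges_def by auto
      have SF: "S \<in> faces G" "e \<in> S" using S unfolding faces_at_def by auto
      have "F \<in> faces_at G f" "S \<in> faces_at G f" "F \<noteq> S"
        using old S SF unfolding faces_at_def by auto
      then have "col F \<noteq> col S" using col_neq[OF colouring] by blast
      moreover have "edge_colour G col f \<noteq> col F" "edge_colour G col f \<noteq> col S"
        "edge_colour G col e \<noteq> col S"
        using old S SF edge_colour_neq_face[OF colouring] by auto
      \<comment> \<open>The shrink face \<open>S\<close> and the edges \<open>e\<close> and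
        \<open>f\<close> carry three different colours, and \<open>F\<close> can have neither the
        colour of \<open>S\<close> nor that of \<open>f\<close>.\<close>
      ultimately have "col F = edge_colour G col e" using ce
        by (cases "col F"; cases "col S"; cases "edge_colour G col e"; cases "edge_colour G col f") auto
      then show False using old S unfolding merge_faces_def by blast
    qed
  next
    case copy
    then show ?thesis using e unfolding copied_edges_def lost_edges_def by auto
  next
    case big
    then have "f \<noteq> e" using edges_at_defect[OF e(1), of u] e(2) by auto
    then show ?thesis using big unfolding lost_edges_def by auto
  qed
qed

lemma copied_edge: "(S, f) \<in> copied_edges \<Longrightarrow> f \<in> edges G - lost_edges"
  using e face_edges unfolding copied_edges_def lost_edges_def faces_at_def by auto

text \<open>Each copy has the ends of an original that survives as well, so the new edges create no
  connection and restore none.\<close>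

lemma ends_result: "ends result ` edges result = ends G ` (edges G - lost_edges)"
proof -
  have "ends result x \<in> ends G ` (edges G - lost_edges)" if "x \<in> edges result" for x
  proof (cases x)
    case (Inl f)
    then show ?thesis using that Inl_in_result_faces_iff[of f] unfolding result_eq by auto
  next
    case (Inr p)
    then show ?thesis using that copied_edge unfolding result_eq by (cases p) auto
  qed
  moreover have "ends G f \<in> ends result ` edges result" if "f \<in> edges G - lost_edges" for f
  proof -
    have "Inl f \<in> edges result" "ends result (Inl f) = ends G f"
      using that Inl_in_result_faces_iff[of f] unfolding result_eq by auto
    then show ?thesis by (metis image_eqI)
  qed
  ultimately show ?thesis by blast
qed

text \<open>Deleting \<open>u\<close> and \<open>w\<close> costs nothing beyond
  \<open>lost_edges\<close>, which already contains every edge at them.\<close>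

lemma cc_adj_result:
  "cc_adj result x y \<longleftrightarrow> x \<noteq> y \<and> (\<exists>f\<in>edges G - lost_edges. ends G f = {x, y})"
proof -
  have "cc_adj result x y \<longleftrightarrow>
    x \<in> verts G - {u, w} \<and> y \<in> verts G - {u, w} \<and> x \<noteq> y \<and> {x, y} \<in> ends result ` edges result"
    unfolding cc_adj_def by (auto simp: result_eq)
  also have "\<dots> \<longleftrightarrow> x \<noteq> y \<and> (\<exists>f\<in>edges G - lost_edges. ends G f = {x, y})"
    unfolding ends_result using lost_edges_at_defect end_in_verts by fastforce
  finally show ?thesis .
qed

text \<open>Since \<open>G\<close> has no parallel edges, no second edge keeps the connection of a
  lost edge alive.\<close>

lemma removed_result: "removed G (cc_adj result) = card lost_edges"
proof -
  have "{{x, y} | x y. cc_adj G x y \<and> \<not> cc_adj result x y} = ends G ` lost_edges" (is "?L = ?R")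
  proof
    show "?L \<subseteq> ?R"
    proof
      fix z assume "z \<in> ?L"
      then obtain x y where z: "z = {x, y}" "cc_adj G x y" "\<not> cc_adj result x y" by blast
      then obtain f where f: "f \<in> edges G" "ends G f = {x, y}" "x \<noteq> y" unfolding cc_adj_def by blast
      then have "f \<in> lost_edges" using z(3) cc_adj_result by blast
      then show "z \<in> ?R" using f(2) z(1) by blast
    qed
    show "?R \<subseteq> ?L"
    proof
      fix z assume "z \<in> ?R"
      then obtain f where f: "f \<in> lost_edges" "z = ends G f" by blast
      have fe: "f \<in> edges G" using f lost_edges_subset by blast
      obtain x y where xy: "x \<in> verts G" "y \<in> verts G" "x \<noteq> y" "ends G f = {x, y}"
        using ends_edge[OF fe] by blast
      have "cc_adj G x y" using xy fe unfolding cc_adj_def by blast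
      moreover have "\<not> cc_adj result x y"
      proof
        assume "cc_adj result x y"
        then obtain g where "g \<in> edges G - lost_edges" "ends G g = {x, y}"
          unfolding cc_adj_result by blast
        then show False using inj_ends fe f xy by (metis DiffE inj_onD)
      qed
      ultimately show "z \<in> ?L" using f xy by blast
    qed
  qed
  moreover have "card (ends G ` lost_edges) = card lost_edges"
    using inj_ends lost_edges_subset by (meson card_image inj_on_subset)
  ultimately show ?thesis unfolding removed_def by simp
qed

lemma card_lost_edges:
  assumes "faces_at G e = {S1, S2}" "S1 \<noteq> S2"
  shows "2 * card lost_edges = 2 + card S1 + card S2"
proof -
  let ?N = "\<lambda>S. {g \<in> S. edge_colour G col g \<noteq> edge_colour G col e}"
  have S: "S1 \<in> faces G" "S2 \<in> faces G" "e \<in> S1" "e \<in> S2"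
    using assms unfolding faces_at_def by auto
  have fin: "finite S1" "finite S2" using S face_edges finite_edges finite_subset by metis+
  \<comment> \<open>The edges lost on \<open>S1\<close> have the colour of \<open>S2\<close>, and
    those lost on \<open>S2\<close> have the colour of \<open>S1\<close>.\<close>
  have "?N S1 \<inter> ?N S2 = {}"
  proof (rule equals0I)
    fix g assume g: "g \<in> ?N S1 \<inter> ?N S2"
    have "edge_colour G col g \<noteq> col S1" "edge_colour G col g \<noteq> col S2"
      "edge_colour G col e \<noteq> col S1" "edge_colour G col e \<noteq> col S2"
      using g S edge_colour_neq_face[OF colouring] by blast+
    moreover have "col S1 \<noteq> col S2" using col_neq[OF colouring] assms by blast
    ultimately show False using g
      by (cases "col S1"; cases "col S2"; cases "edge_colour G col e"; cases "edge_colour G col g") auto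
  qed
  moreover have "lost_edges = insert e (?N S1 \<union> ?N S2)"
    unfolding lost_edges_def using assms by auto
  ultimately have "card lost_edges = 1 + card (?N S1) + card (?N S2)"
    using fin by (simp add: card_Un_disjoint)
  moreover have "2 * card (?N S1) = card S1" "2 * card (?N S2) = card S2"
    using card_face_other_colour[OF colouring] edge_colour_neq_face[OF colouring] S by blast+
  ultimately show ?thesis by simp
qed

end

section \<open>Double edges of a competing lattice\<close>

context
  fixes H :: "('d, 'v) cmap"
  assumes H: "toroidal_cc_map H"
begin

lemma alpha_dart:
  "d \<in> darts H \<Longrightarrow> alpha H d \<in> darts H" "d \<in> darts H \<Longrightarrow> alpha H (alpha H d) = d"
  using H unfolding toroidal_cc_map_def by auto

lemma finite_darts: "finite (darts H)"
  using H unfolding toroidal_cc_map_def by auto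

lemma sigma_dart:
  assumes "d \<in> darts H"
  shows "sigma H d \<in> darts H" "vlabel H (sigma H d) = vlabel H d"
proof -
  have b: "bij_betw (sigma H) (darts H) (darts H)" and
    l: "\<forall>d\<in>darts H. \<forall>d'\<in>darts H. vlabel H d = vlabel H d' \<longleftrightarrow> d' \<in> orb (sigma H) d"
    using H unfolding toroidal_cc_map_def by auto
  show s: "sigma H d \<in> darts H" using b assms bij_betwE by blast
  have "sigma H d \<in> orb (sigma H) d" unfolding orb_def by (auto intro: exI[of _ 1])
  then show "vlabel H (sigma H d) = vlabel H d" using l assms s by metis
qed

lemma card_darts_at:
  assumes "v \<in> vlabel H ` darts H"
  shows "card {d \<in> darts H. vlabel H d = v} = 3"
proof -
  obtain d where d: "d \<in> darts H" "vlabel H d = v" using assms by blast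
  have l: "\<forall>d\<in>darts H. \<forall>d'\<in>darts H. vlabel H d = vlabel H d' \<longleftrightarrow> d' \<in> orb (sigma H) d"
    and c: "card (orb (sigma H) d) = 3"
    using H d unfolding toroidal_cc_map_def by auto
  have "(sigma H ^^ n) d \<in> darts H" for n
    by (induction n) (use d sigma_dart in auto)
  then have "orb (sigma H) d \<subseteq> darts H" unfolding orb_def by auto
  then have "{d \<in> darts H. vlabel H d = v} = orb (sigma H) d"
    using l d by (smt (verit) Collect_cong Collect_mem_eq subsetD)
  then show ?thesis using c by simp
qed

text \<open>Number of parallel edges: in the absence of loops, each edge between \<open>v\<close>
  and \<open>y\<close> contributes exactly one dart at \<open>v\<close>.\<close>

definition mult :: "'v \<Rightarrow> 'v \<Rightarrow> nat" where
  "mult v y = card {d \<in> darts H. vlabel H d = v \<and> vlabel H (alpha H d) = y}"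

lemma mult_sym: "mult v y = mult y v"
proof -
  have "bij_betw (alpha H) {d \<in> darts H. vlabel H d = v \<and> vlabel H (alpha H d) = y}
     {d \<in> darts H. vlabel H d = y \<and> vlabel H (alpha H d) = v}"
    by (rule bij_betw_byWitness[where f' = "alpha H"]) (auto simp: alpha_dart)
  then show ?thesis unfolding mult_def by (rule bij_betw_same_card)
qed

lemma map_adj_iff_mult: "map_adj H v y \<longleftrightarrow> mult v y > 0"
  unfolding map_adj_def mult_def card_gt_0_iff using finite_darts by auto

lemma map_adj_sym: "map_adj H v y \<longleftrightarrow> map_adj H y v"
  unfolding map_adj_iff_mult by (simp add: mult_sym)

lemma map_adj_labels: "map_adj H v y \<Longrightarrow> v \<in> vlabel H ` darts H"
  unfolding map_adj_def by blast

lemma neighbours_eq: "{y. map_adj H v y} = (\<lambda>d. vlabel H (alpha H d)) ` {d \<in> darts H. vlabel H d = v}"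
  unfolding map_adj_def by auto

lemma finite_neighbours: "finite {y. map_adj H v y}"
  unfolding neighbours_eq using finite_darts by simp

lemma sum_mult:
  assumes "v \<in> vlabel H ` darts H"
  shows "(\<Sum>y | map_adj H v y. mult v y) = 3"
proof -
  have "{d \<in> darts H. vlabel H d = v} =
    (\<Union>y\<in>{y. map_adj H v y}. {d \<in> darts H. vlabel H d = v \<and> vlabel H (alpha H d) = y})"
    unfolding map_adj_def by auto
  moreover have "card \<dots> = (\<Sum>y | map_adj H v y. mult v y)"
    unfolding mult_def
    by (rule card_UN_disjoint) (auto simp: finite_darts finite_neighbours)
  ultimately show ?thesis using card_darts_at[OF assms] by simp
qed

text \<open>A triple edge would be a whole connected component.\<close>

lemma two_neighbours:
  assumes v: "v \<in> vlabel H ` darts H" and z: "x \<in> vlabel H ` darts H" "x' \<in> vlabel H ` darts H"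
    "distinct [v, x, x']"
  shows "\<exists>y y'. map_adj H v y \<and> map_adj H v y' \<and> y \<noteq> y'"
proof (rule ccontr)
  assume "\<not> ?thesis"
  moreover have "{y. map_adj H v y} \<noteq> {}" using sum_mult[OF v] by force
  ultimately obtain y where y: "{y. map_adj H v y} = {y}" by blast
  then have "mult v y = 3" using sum_mult[OF v] by simp
  moreover have yl: "y \<in> vlabel H ` darts H"
    using y map_adj_sym[of v y] map_adj_labels[of y v] by blast
  ultimately have "card {d \<in> darts H. vlabel H d = y} = card {d \<in> darts H. vlabel H d = y \<and> vlabel H (alpha H d) = v}"
    using card_darts_at[OF yl] mult_sym[of v y] unfolding mult_def by simp
  then have "{d \<in> darts H. vlabel H d = y \<and> vlabel H (alpha H d) = v} = {d \<in> darts H. vlabel H d = y}"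
    by (intro card_subset_eq) (auto simp: finite_darts)
  then have yv: "vlabel H (alpha H d) = v" if "d \<in> darts H" "vlabel H d = y" for d using that by auto
  have vy: "vlabel H (alpha H d) = y" if "d \<in> darts H" "vlabel H d = v" for d
    using that y unfolding map_adj_def by auto
  obtain d0 where d0: "d0 \<in> darts H" "vlabel H d0 = v" using v by blast
  have "vlabel H d \<in> {v, y}" if "d \<in> darts H" for d
  proof -
    have "(d0, d) \<in> ({(x, alpha H x) | x. x \<in> darts H} \<union> {(x, sigma H x) | x. x \<in> darts H})\<^sup>*"
      using H d0 that unfolding toroidal_cc_map_def by blast
    then show ?thesis
      by (induction rule: rtrancl_induct) (use d0 yv vy sigma_dart in auto)
  qed
  then have "{v, x, x'} \<subseteq> {v, y}" using assms by blast
  then have "card {v, x, x'} \<le> card {v, y}" by (intro card_mono) auto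
  moreover have "card {v, x, x'} = 3" using z(3) by simp
  moreover have "card {v, y} \<le> 2" by (simp add: card_insert_if)
  ultimately show False by simp
qed

text \<open>Three darts spread over two neighbours can only split as 2 + 1.\<close>

lemma ex_double_edge:
  assumes v: "v \<in> vlabel H ` darts H" and c: "card {y. map_adj H v y} = 2"
  shows "\<exists>z. mult v z = 2"
proof -
  obtain y y' where y: "{y. map_adj H v y} = {y, y'}" "y \<noteq> y'" using c card_2_iff by metis
  then have "mult v y + mult v y' = 3" using sum_mult[OF v] by simp
  moreover have "mult v y > 0" "mult v y' > 0" using y map_adj_iff_mult by blast+
  ultimately have "mult v y = 2 \<or> mult v y' = 2" by linarith
  then show ?thesis by blast
qed

lemma double_edge_unique:
  assumes "mult v y = 2" "mult v y' = 2"
  shows "y = y'"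
proof (rule ccontr)
  assume "y \<noteq> y'"
  have a: "map_adj H v y" "map_adj H v y'" using assms by (auto simp: map_adj_iff_mult)
  have "(\<Sum>z\<in>{y, y'}. mult v z) \<le> (\<Sum>z | map_adj H v z. mult v z)"
    using a finite_neighbours by (intro sum_mono2) auto
  then show False using \<open>y \<noteq> y'\<close> assms sum_mult[OF map_adj_labels[OF a(1)]] by simp
qed

text \<open>After a double edge only one dart is left for further neighbours. This is the converse
  half of the matching: a vertex with a double edge has lost a connection.\<close>

lemma card_neighbours_double:
  assumes "mult v y = 2"
  shows "card {y. map_adj H v y} \<le> 2"
proof -
  have a: "map_adj H v y" using assms by (auto simp: map_adj_iff_mult)
  have "3 = mult v y + (\<Sum>z\<in>{z. map_adj H v z} - {y}. mult v z)"
    using sum_mult[OF map_adj_labels[OF a]] a finite_neighbours by (simp add: sum.remove[of _ y])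
  moreover have "(\<Sum>z\<in>{z. map_adj H v z} - {y}. mult v z) \<ge> card ({z. map_adj H v z} - {y})"
    using sum_mono[of "{z. map_adj H v z} - {y}" "\<lambda>_. 1" "mult v"] by (auto simp: map_adj_iff_mult)
  ultimately show ?thesis using assms a finite_neighbours by simp
qed

end

text \<open>Below, \<open>A\<close> is the adjacency of the original lattice, \<open>B\<close> that of the competing lattice and
  \<open>dbl\<close> its double edges. They match up the vertices that have lost a neighbour.\<close>

locale defect_matching =
  fixes A B dbl :: "'v \<Rightarrow> 'v \<Rightarrow> bool" and u w x1 x2 y1 y2 :: 'v
  assumes A_irrefl: "\<not> A x x" and A_sym: "A x y \<Longrightarrow> A y x"
    and B_sym: "B x y \<Longrightarrow> B y x" and B_A: "B x y \<Longrightarrow> A x y"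
    and B_defect: "\<not> B u x" "\<not> B w x"
    and nbrs: "A u x \<longleftrightarrow> x \<in> {w, x1, x2}" "A w x \<longleftrightarrow> x \<in> {u, y1, y2}"
    and dist: "distinct [u, w, x1, x2, y1, y2]"
    and fin: "finite {{x, y} | x y. A x y \<and> \<not> B x y}"
    and one_lost: "v \<notin> {u, w} \<Longrightarrow> A v y \<Longrightarrow> \<not> B v y \<Longrightarrow> A v y' \<Longrightarrow> \<not> B v y' \<Longrightarrow> y = y'"
    and ex_dbl: "v \<notin> {u, w} \<Longrightarrow> A v y \<Longrightarrow> \<not> B v y \<Longrightarrow> \<exists>z. dbl v z"
    and dbl_B: "dbl v z \<Longrightarrow> B v z"
    and dbl_lost: "dbl v z \<Longrightarrow> \<exists>y. A v y \<and> \<not> B v y"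
    and dbl_sym: "dbl v z \<Longrightarrow> dbl z v"
    and dbl_unique: "dbl v z \<Longrightarrow> dbl v z' \<Longrightarrow> z = z'"
    and no_triangle: "\<not> A x1 x2" "\<not> A y1 y2"
    and no_two_squares: "\<not> (A x1 y1 \<and> A x2 y2)" "\<not> (A x1 y2 \<and> A x2 y1)"
begin

definition lost :: "'v set set" where
  "lost = {{x, y} | x y. A x y \<and> \<not> B x y}"

text \<open>What every competitor loses: 3 + 3 edges at the deleted vertices, with their common edge
  counted once.\<close>

definition core :: "'v set set" where
  "core = {{u, w}, {u, x1}, {u, x2}, {w, y1}, {w, y2}}"

lemma card_core: "card core = 5" "finite core"
  using dist unfolding core_def by (auto simp: card_insert_if doubleton_eq_iff)

lemma core_lost: "core \<subseteq> lost"
  using nbrs B_defect unfolding core_def lost_def by blast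

lemma lost_iff: "{x, y} \<in> lost \<longleftrightarrow> A x y \<and> \<not> B x y"
  unfolding lost_def using A_sym B_sym by (auto simp: doubleton_eq_iff)

lemma lost_defect: "{x, y} \<in> lost \<Longrightarrow> x \<in> {u, w} \<Longrightarrow> {x, y} \<in> core"
  unfolding lost_iff core_def using nbrs(1)[of y] nbrs(2)[of y] by (auto simp: doubleton_eq_iff)

lemma dbl_not_defect: "dbl v z \<Longrightarrow> v \<notin> {u, w} \<and> z \<notin> {u, w}"
  using dbl_B B_sym B_defect by blast

lemma dbl_exists: "\<exists>z. dbl x1 z" "\<exists>z. dbl x2 z" "\<exists>z. dbl y1 z" "\<exists>z. dbl y2 z"
proof -
  have "A x1 u" "A x2 u" "A y1 w" "A y2 w" using nbrs A_sym by auto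
  moreover have "\<not> B x1 u" "\<not> B x2 u" "\<not> B y1 w" "\<not> B y2 w" using B_sym B_defect by blast+
  ultimately show "\<exists>z. dbl x1 z" "\<exists>z. dbl x2 z" "\<exists>z. dbl y1 z" "\<exists>z. dbl y2 z"
    using ex_dbl dist by auto
qed

lemma dbl_A: "dbl v z \<Longrightarrow> A v z" using dbl_B B_A by blast

lemma core_vertex: "{v, y} \<in> core \<Longrightarrow> v \<notin> {u, w} \<Longrightarrow> v \<in> {x1, x2, y1, y2}"
  unfolding core_def by (auto simp: doubleton_eq_iff)

text \<open>Otherwise only the four neighbours have lost a connection, so they are matched among
  themselves. Pairs on the same side would close a triangle, so both pairs cross over and give two
  squares.\<close>

lemma lost_neq_core: "lost \<noteq> core"
proof
  assume eq: "lost = core"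
  \<comment> \<open>The partner of a matched vertex carries the same double edge, so it has lost a
    connection too.\<close>
  have mem: "z \<in> {x1, x2, y1, y2}" if vz: "dbl v z" for v z
  proof -
    obtain y where "A z y" "\<not> B z y" using vz dbl_lost dbl_sym by blast
    then show ?thesis using eq lost_iff core_vertex dbl_not_defect[OF vz] by metis
  qed
  obtain z1 z2 where z: "dbl x1 z1" "dbl x2 z2" using dbl_exists by blast
  have "z1 \<in> {y1, y2}"
    using z(1) mem[OF z(1)] mem[OF dbl_sym[OF z(1)]] dbl_A A_irrefl no_triangle by auto
  moreover have "z2 \<in> {y1, y2}"
    using z(2) mem[OF z(2)] dbl_A A_irrefl A_sym[of x2 x1] no_triangle by auto
  moreover have "z1 \<noteq> z2" using dbl_sym[OF z(1)] dbl_sym[OF z(2)] dbl_unique dist by auto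
  ultimately show False using z dbl_A no_two_squares by auto
qed

lemma card_lost_ge_6: "card lost \<ge> 6"
proof -
  have "core \<subset> lost" using core_lost lost_neq_core by blast
  then show ?thesis using psubset_card_mono[of lost core] fin card_core lost_def by auto
qed

text \<open>With a single further loss \<open>{p, q}\<close>, the matched vertices are
  \<open>p\<close>, \<open>q\<close> and the four neighbours. If the partners of \<open>p\<close>
  and \<open>q\<close> are on the same side, the other two neighbours are adjacent and close a
  triangle. Otherwise the other two close a square with \<open>u\<close> and \<open>w\<close>, and
  the partners close a hexagon with \<open>p\<close>, \<open>q\<close>, \<open>u\<close> and
  \<open>w\<close>.\<close>

lemma card_lost_ge_7:
  assumes no_hexagon: "\<And>x x' y y' p q. {x, x'} = {x1, x2} \<Longrightarrow> {y, y'} = {y1, y2} \<Longrightarrow>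
    A x y \<Longrightarrow> A x' p \<Longrightarrow> A y' q \<Longrightarrow> A p q \<Longrightarrow>
    {p, q} \<inter> {u, w, x1, x2, y1, y2} = {} \<Longrightarrow> False"
  shows "card lost \<ge> 7"
proof (rule ccontr)
  assume "\<not> 7 \<le> card lost"
  then have "card lost = 6" using card_lost_ge_6 by simp
  then have "card (lost - core) = 1" using card_core core_lost by (simp add: card_Diff_subset)
  then obtain r where "lost - core = {r}" by (rule card_1_singletonE)
  then have r: "lost = insert r core" "r \<notin> core" using core_lost by blast+
  have "r \<in> lost" using r by simp
  then obtain p q where pq: "r = {p, q}" "A p q" "\<not> B p q" unfolding lost_def by blast
  have pq': "A q p" "\<not> B q p" using pq A_sym B_sym by blast+
  have pl: "{p, q} \<in> lost" "{q, p} \<in> lost" using lost_iff pq pq' by simp_all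
  have nd: "p \<notin> {u, w}" "q \<notin> {u, w}"
    using lost_defect[OF pl(1)] lost_defect[OF pl(2)] r(2) pq(1) insert_commute[of p q "{}"] by auto
  have xu: "A x1 u" "A x2 u" "A y1 w" "A y2 w" using nbrs A_sym by auto
  have xu': "\<not> B x1 u" "\<not> B x2 u" "\<not> B y1 w" "\<not> B y2 w" using B_sym B_defect by blast+
  \<comment> \<open>Each of the four has already lost its connection to \<open>u\<close> or
    \<open>w\<close>, and no vertex loses two.\<close>
  have new: "v \<notin> {x1, x2, y1, y2}" if "{v, v'} = {p, q}" for v v'
  proof -
    have v: "A v v'" "\<not> B v v'" "v \<notin> {u, w}" "v' \<notin> {u, w}"
      using that pq pq' nd by (auto simp: doubleton_eq_iff)
    show ?thesis using v xu xu' one_lost[OF v(3,1,2)] by fastforce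
  qed
  have pnew: "p \<notin> {x1, x2, y1, y2}" "q \<notin> {x1, x2, y1, y2}"
    using new[of p q] new[of q p] insert_commute[of p q "{}"] by simp_all
  have mem: "z \<in> {x1, x2, y1, y2, p, q}" if vz: "dbl v z" for v z
  proof -
    obtain y where "A z y" "\<not> B z y" using vz dbl_lost dbl_sym by blast
    then have "{z, y} \<in> lost" by (simp add: lost_iff)
    then have "{z, y} = {p, q} \<or> {z, y} \<in> core" using r pq by auto
    then show ?thesis
      using core_vertex[of z y] dbl_not_defect[OF vz] by (auto simp: doubleton_eq_iff)
  qed
  obtain p' q' where p': "dbl p p'" and q': "dbl q q'" using ex_dbl nd pq pq' by blast
  have p'B: "B p p'" "B q q'" using p' q' dbl_B by auto
  \<comment> \<open>The vertex \<open>p\<close> cannot be matched to \<open>q\<close>, since a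
    double edge is a kept connection and \<open>{p, q}\<close> is lost.\<close>
  have p'_in: "p' \<in> {x1, x2, y1, y2}"
    using mem[OF p'] p'B pq A_irrefl B_A by auto
  have q'_in: "q' \<in> {x1, x2, y1, y2}"
    using mem[OF q'] p'B pq' A_irrefl B_A by auto
  have neq: "p' \<noteq> q'" using dbl_sym[OF p'] dbl_sym[OF q'] dbl_unique pq A_irrefl by blast
  text \<open>Two of the four vertices are matched to \<open>p\<close> and \<open>q\<close>, so the other two are matched to each
    other.\<close>
  have rest: "z \<in> {x1, x2, y1, y2} - {p', q'} \<and> z \<noteq> v"
    if "v \<in> {x1, x2, y1, y2}" "v \<noteq> p'" "v \<noteq> q'" "dbl v z" for v z
  proof -
    have "z \<noteq> p" "z \<noteq> q" using that dbl_sym[OF that(4)] p' q' dbl_unique by blast+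
    moreover have "z \<noteq> p'" "z \<noteq> q'"
      using that dbl_sym[OF that(4)] dbl_sym[OF p'] dbl_sym[OF q'] dbl_unique pnew by blast+
    moreover have "z \<noteq> v" using that dbl_A A_irrefl by blast
    ultimately show ?thesis using mem[OF that(4)] by auto
  qed
  have pair: "A v z" if "{x1, x2, y1, y2} = {p', q', v, z}" "distinct [p', q', v, z]" for v z
  proof -
    have "v \<in> {x1, x2, y1, y2}" using that by auto
    moreover obtain t where t: "dbl v t"
      using calculation dbl_exists by blast
    ultimately have "t \<in> {p', q', v, z} - {p', q'} \<and> t \<noteq> v"
      using rest[of v t] that by auto
    then show ?thesis using t dbl_A by auto
  qed
  have disj: "{p, q} \<inter> {u, w, x1, x2, y1, y2} = {}" "{q, p} \<inter> {u, w, x1, x2, y1, y2} = {}"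
    using pnew nd by auto
  have Apq: "A p' p" "A q' q" using p'B B_A A_sym by blast+
  have other: "\<exists>t. {t, s} = {s1, s2}" if "s \<in> {s1, s2}" for s s1 s2 :: 'v
    using that by (metis insertE insert_commute singletonD)
  consider "{p', q'} \<subseteq> {x1, x2}" | "{p', q'} \<subseteq> {y1, y2}"
    | "p' \<in> {x1, x2}" "q' \<in> {y1, y2}" | "q' \<in> {x1, x2}" "p' \<in> {y1, y2}"
    using p'_in q'_in by blast
  then show False
  proof cases
    case 1
    then have "A y1 y2" using pair[of y1 y2] dist neq by auto
    then show False using no_triangle by simp
  next
    case 2
    then have "A x1 x2" using pair[of x1 x2] dist neq by auto
    then show False using no_triangle by simp
  next
    case 3
    then obtain x y where x: "{x, p'} = {x1, x2}" and y: "{y, q'} = {y1, y2}" using other by meson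
    have "{x1, x2, y1, y2} = {p', q', x, y}" using x y by auto
    moreover have "distinct [x, p', y, q']" using x y dist by (auto simp: doubleton_eq_iff)
    ultimately have "A x y" using pair[of x y] by auto
    then show False using no_hexagon[OF x y _ Apq pq(2) disj(1)] by blast
  next
    case 4
    then obtain x y where x: "{x, q'} = {x1, x2}" and y: "{y, p'} = {y1, y2}" using other by meson
    have "{x1, x2, y1, y2} = {p', q', x, y}" using x y by auto
    moreover have "distinct [x, p', y, q']" using x y dist by (auto simp: doubleton_eq_iff)
    ultimately have "A x y" using pair[of x y] by auto
    then show False using no_hexagon[OF x y _ Apq(2,1) pq'(1) disj(2)] by blast
  qed
qed

end

section \<open>From a competing lattice to the matching\<close>

context cubic_cell_graph
begin

lemma cc_adj_irrefl: "\<not> cc_adj G x x"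
  by (simp add: cc_adj_def)

lemma cc_adj_sym: "cc_adj G x y \<Longrightarrow> cc_adj G y x"
  unfolding cc_adj_def by (metis insert_commute)

lemma finite_adjacent_pairs: "finite {{x, y} | x y. cc_adj G x y \<and> P x y}"
proof (rule finite_subset)
  show "{{x, y} | x y. cc_adj G x y \<and> P x y} \<subseteq> ends G ` edges G"
    unfolding cc_adj_def by force
qed (use finite_edges in simp)

lemma card_neighbours:
  assumes v: "v \<in> verts G"
  shows "card {y. cc_adj G v y} = 3"
proof -
  obtain e1 e2 e3 F12 F13 F23 where "is_corner G v e1 e2 e3 F12 F13 F23"
    using corner[OF v] by blast
  then have 3: "card {f \<in> edges G. v \<in> ends G f} = 3" unfolding is_corner_def by auto
  have eq: "ends G ` {f \<in> edges G. v \<in> ends G f} = (\<lambda>y. {v, y}) ` {y. cc_adj G v y}"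
  proof (intro set_eqI iffI)
    fix z assume "z \<in> ends G ` {f \<in> edges G. v \<in> ends G f}"
    then obtain f where f: "f \<in> edges G" "v \<in> ends G f" "z = ends G f" by blast
    obtain x y where "x \<in> verts G" "y \<in> verts G" "x \<noteq> y" "ends G f = {x, y}"
      using ends_edge[OF f(1)] by blast
    then have "\<exists>y. z = {v, y} \<and> v \<noteq> y \<and> y \<in> verts G" using f by auto
    then show "z \<in> (\<lambda>y. {v, y}) ` {y. cc_adj G v y}" using f v unfolding cc_adj_def by blast
  next
    fix z assume "z \<in> (\<lambda>y. {v, y}) ` {y. cc_adj G v y}"
    then show "z \<in> ends G ` {f \<in> edges G. v \<in> ends G f}" unfolding cc_adj_def by force
  qed
  have "inj_on (ends G) {f \<in> edges G. v \<in> ends G f}"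
    using inj_ends by (rule inj_on_subset) auto
  then have "card (ends G ` {f \<in> edges G. v \<in> ends G f}) = 3" using 3 by (simp add: card_image)
  moreover have "inj_on (\<lambda>y. {v, y}) {y. cc_adj G v y}"
    by (auto simp: inj_on_def doubleton_eq_iff)
  then have "card ((\<lambda>y. {v, y}) ` {y. cc_adj G v y}) = card {y. cc_adj G v y}" by (rule card_image)
  ultimately show ?thesis using eq by simp
qed

text \<open>Every remaining vertex keeps at least two of its three neighbours, by connectedness. So
  a loss leaves exactly two, and degree 3 then forces a double edge; conversely a double edge leaves
  at most two neighbours.\<close>

lemma competitor_defect_matching:
  fixes H :: "('d, 'v) cmap"
  assumes H: "toroidal_cc_map H" and uw: "cc_adj G u w"
    and labels: "vlabel H ` darts H = verts G - {u, w}"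
    and HG: "\<forall>d\<in>darts H. cc_adj G (vlabel H d) (vlabel H (alpha H d))"
    and no_triangle: "\<And>x y z. cc_adj G y x \<Longrightarrow> cc_adj G y z \<Longrightarrow> \<not> cc_adj G x z"
    and no_two_squares: "\<And>x x' y y'. distinct [u, w, x, x', y, y'] \<Longrightarrow>
      cc_adj G u x \<Longrightarrow> cc_adj G u x' \<Longrightarrow> cc_adj G w y \<Longrightarrow> cc_adj G w y' \<Longrightarrow>
      cc_adj G x y \<Longrightarrow> cc_adj G x' y' \<Longrightarrow> False"
  shows "\<exists>x1 x2 y1 y2.
    defect_matching (cc_adj G) (map_adj H) (\<lambda>v z. mult H v z = 2) u w x1 x2 y1 y2"
proof -
  have verts: "u \<in> verts G" "w \<in> verts G" "u \<noteq> w" "cc_adj G w u"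
    using uw cc_adj_sym[OF uw] unfolding cc_adj_def by auto
  have three: "\<exists>x1 x2. {y. cc_adj G v y} = {z, x1, x2} \<and> distinct [z, x1, x2]"
    if "v \<in> verts G" "cc_adj G v z" for v z
  proof -
    have "card ({y. cc_adj G v y} - {z}) = 2" using card_neighbours[OF that(1)] that(2) by simp
    then obtain x1 x2 where "{y. cc_adj G v y} - {z} = {x1, x2}" "x1 \<noteq> x2"
      by (meson card_2_iff)
    then have "{y. cc_adj G v y} = {z, x1, x2} \<and> distinct [z, x1, x2]" using that(2) by auto
    then show ?thesis by blast
  qed
  obtain x1 x2 where x: "{y. cc_adj G u y} = {w, x1, x2}" "distinct [w, x1, x2]"
    using three[OF verts(1) uw] by blast
  obtain y1 y2 where y: "{x. cc_adj G w x} = {u, y1, y2}" "distinct [u, y1, y2]"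
    using three[OF verts(2,4)] by blast
  have xa: "cc_adj G u x1" "cc_adj G u x2" and ya: "cc_adj G w y1" "cc_adj G w y2"
    using x y by blast+
  have "x1 \<noteq> u" "x2 \<noteq> u" "y1 \<noteq> w" "y2 \<noteq> w" using xa ya cc_adj_irrefl by blast+
  \<comment> \<open>A common neighbour of \<open>u\<close> and \<open>w\<close> would close a
    triangle.\<close>
  moreover have "x1 \<noteq> y1" "x1 \<noteq> y2" "x2 \<noteq> y1" "x2 \<noteq> y2"
    using xa ya no_triangle[OF uw] by blast+
  ultimately have dist: "distinct [u, w, x1, x2, y1, y2]" using x(2) y(2) verts(3) by auto
  have vx: "x1 \<in> verts G" "x2 \<in> verts G" "y1 \<in> verts G" using xa ya unfolding cc_adj_def by auto
  have BA: "cc_adj G v z" if "map_adj H v z" for v z using that HG unfolding map_adj_def by auto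
  have two: "card {y. map_adj H v y} \<ge> 2" if v: "v \<in> verts G" "v \<notin> {u, w}" for v
  proof -
    \<comment> \<open>Among three surviving vertices two differ from \<open>v\<close>; they witness
      that \<open>v\<close> and one neighbour are not the whole of \<open>H\<close>.\<close>
    have "\<exists>x x'. {x, x'} \<subseteq> {x1, x2, y1} \<and> distinct [v, x, x']"
    proof (cases "v = x1")
      case True then show ?thesis using dist by (intro exI[of _ x2] exI[of _ y1]) auto
    next
      case F: False
      show ?thesis
      proof (cases "v = x2")
        case True then show ?thesis using dist by (intro exI[of _ x1] exI[of _ y1]) auto
      next
        case False then show ?thesis using F dist by (intro exI[of _ x1] exI[of _ x2]) auto
      qed
    qed
    then obtain x x' where xx: "{x, x'} \<subseteq> {x1, x2, y1}" "distinct [v, x, x']" by blast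
    have "{x1, x2, y1} \<subseteq> vlabel H ` darts H" using labels vx dist by auto
    then have xl: "x \<in> vlabel H ` darts H" "x' \<in> vlabel H ` darts H" using xx(1) by auto
    have "v \<in> vlabel H ` darts H" using labels v by auto
    then obtain z z' where z: "map_adj H v z" "map_adj H v z'" "z \<noteq> z'"
      using two_neighbours[OF H _ xl xx(2)] by blast
    then have "card {z, z'} \<le> card {y. map_adj H v y}"
      using finite_neighbours[OF H] by (intro card_mono) auto
    then show ?thesis using z(3) by simp
  qed
  have fin: "finite {y. cc_adj G v y}" if "v \<in> verts G" for v
    using card_neighbours[OF that] by (metis card.infinite zero_neq_numeral)
  have av: "v \<in> verts G" if "cc_adj G v z" for v z using that unfolding cc_adj_def by auto
  have "defect_matching (cc_adj G) (map_adj H) (\<lambda>v z. mult H v z = 2) u w x1 x2 y1 y2"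
  proof
    fix v z z' y y'
    show "\<not> cc_adj G v v" by (rule cc_adj_irrefl)
    show "cc_adj G v z \<Longrightarrow> cc_adj G z v" by (rule cc_adj_sym)
    show "map_adj H v z \<Longrightarrow> map_adj H z v" using map_adj_sym[OF H] by blast
    show "map_adj H v z \<Longrightarrow> cc_adj G v z" by (rule BA)
    show "\<not> map_adj H u v" "\<not> map_adj H w v" using map_adj_labels[OF H] labels by blast+
    show "cc_adj G u v \<longleftrightarrow> v \<in> {w, x1, x2}" "cc_adj G w v \<longleftrightarrow> v \<in> {u, y1, y2}"
      using x(1) y(1) by blast+
    show "distinct [u, w, x1, x2, y1, y2]" by (rule dist)
    show "finite {{x, y} | x y. cc_adj G x y \<and> \<not> map_adj H x y}" by (rule finite_adjacent_pairs)
    show "y = y'" if v: "v \<notin> {u, w}" and "cc_adj G v y" "\<not> map_adj H v y"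
      "cc_adj G v y'" "\<not> map_adj H v y'"
    proof (rule ccontr)
      assume "y \<noteq> y'"
      have vv: "v \<in> verts G" using that av by blast
      have "card {y. map_adj H v y} \<le> card ({y. cc_adj G v y} - {y, y'})"
        using that BA fin[OF vv] by (intro card_mono) auto
      also have "\<dots> = 1" using that \<open>y \<noteq> y'\<close> card_neighbours[OF vv] fin[OF vv] by (simp add: card_Diff_subset)
      finally show False using two[OF vv v] by simp
    qed
    show "\<exists>z. mult H v z = 2" if v: "v \<notin> {u, w}" and "cc_adj G v y" "\<not> map_adj H v y"
    proof -
      have vv: "v \<in> verts G" using that av by blast
      have "card {y. map_adj H v y} \<le> card ({y. cc_adj G v y} - {y})"
        using that BA fin[OF vv] by (intro card_mono) auto
      also have "\<dots> = 2" using that card_neighbours[OF vv] fin[OF vv] by (simp add: card_Diff_subset)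
      finally have "card {y. map_adj H v y} = 2" using two[OF vv v] by simp
      moreover have "v \<in> vlabel H ` darts H" using labels vv v by auto
      ultimately show ?thesis using ex_double_edge[OF H] by blast
    qed
    show B: "map_adj H v z" if "mult H v z = 2" using that map_adj_iff_mult[OF H] by simp
    show "\<exists>y. cc_adj G v y \<and> \<not> map_adj H v y" if "mult H v z = 2"
    proof (rule ccontr)
      assume "\<not> ?thesis"
      then have "{y. map_adj H v y} = {y. cc_adj G v y}" using BA by blast
      moreover have "v \<in> verts G" using av BA B[OF that] by blast
      ultimately show False using card_neighbours_double[OF H that] card_neighbours by simp
    qed
    show "mult H v z = 2 \<Longrightarrow> mult H z v = 2" using mult_sym[OF H] by simp
    show "mult H v z = 2 \<Longrightarrow> mult H v z' = 2 \<Longrightarrow> z = z'" by (rule double_edge_unique[OF H])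
    show "\<not> cc_adj G x1 x2" "\<not> cc_adj G y1 y2" using no_triangle xa ya by blast+
    show "\<not> (cc_adj G x1 y1 \<and> cc_adj G x2 y2)"
      using no_two_squares[of x1 x2 y1 y2] dist xa ya by blast
    have "distinct [u, w, x1, x2, y2, y1]" using dist by auto
    then show "\<not> (cc_adj G x1 y2 \<and> cc_adj G x2 y1)"
      using no_two_squares[of x1 x2 y2 y1] xa ya by blast
  qed
  then show ?thesis by blast
qed

end

section \<open>Finite checks in the plane\<close>

definition cneg :: "cell \<Rightarrow> cell" where
  "cneg p = (- fst p, - snd p)"

text \<open>Vertices, edges and faces of the plane tiling are given as pairs of a cell, relative to some base
  cell, and a type. \<open>star T k\<close> lists the edges at the vertex of type \<open>k\<close> in the base cell,
  each with its other end.\<close>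

definition star :: "tiling \<Rightarrow> nat \<Rightarrow> (ledge \<times> lvert) list" where
  "star T k = concat (map (\<lambda>(i, k1, d, k2).
      (if k1 = k then [(((0, 0), i), (d, k2))] else []) @
      (if k2 = k then [((cneg d, i), (cneg d, k1))] else [])) (enumerate 0 (etypes T)))"

definition nbrs_of :: "tiling \<Rightarrow> lvert \<Rightarrow> lvert list" where
  "nbrs_of T r = map (\<lambda>(_, d, l). (cadd (fst r) d, l)) (star T (snd r))"

text \<open>A face at cell \<open>q\<close> has its edges at \<open>cadd q off\<close>, so the cell
  of the face is found by subtracting the offset.\<close>

definition faces_of :: "tiling \<Rightarrow> ledge \<Rightarrow> (cell \<times> nat) list" where
  "faces_of T x = concat (map (\<lambda>j. concat (map (\<lambda>y.
      if snd y = snd x then [(cadd (fst x) (cneg (fst y)), j)] else []) (ftypes T ! j)))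
    [0..<length (ftypes T)])"

text \<open>Balls about one vertex suffice: periods are translations, so a path from
  \<open>((0, 0), 0)\<close> to \<open>(d, 0)\<close> tests \<open>d\<close> for every type.\<close>

fun reach :: "tiling \<Rightarrow> nat \<Rightarrow> lvert list" where
  "reach T 0 = [((0, 0), 0)]"
| "reach T (Suc n) = remdups (reach T n @ concat (map (nbrs_of T) (reach T n)))"

text \<open>Up to sign, all differences of cells that have to be told apart modulo the period lattice in the
  checks below. For 4.6.12 the types alone suffice.\<close>

fun short :: "tiling \<Rightarrow> cell list" where
  "short Honeycomb = [(0, 1), (1, 0), (1, -1), (1, 1), (2, -1), (1, -2), (2, 0), (0, 2), (2, -2)]"
| "short Tiling_488 = [(0, 1), (1, 0), (1, 1), (1, -1), (2, 0), (0, 2)]"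
| "short Tiling_4612 = []"

text \<open>A certificate for being distinct on the torus, not an equivalence: its failure says
  nothing. Both orders are tried because \<open>short\<close> is listed up to sign.
  \<open>nonadj\<close> and \<open>avoids\<close> inherit this one-sided character.\<close>

definition apart :: "tiling \<Rightarrow> cell \<times> nat \<Rightarrow> cell \<times> nat \<Rightarrow> bool" where
  "apart T x y \<longleftrightarrow> snd x \<noteq> snd y \<or> cadd (fst x) (cneg (fst y)) \<in> set (short T)
     \<or> cadd (fst y) (cneg (fst x)) \<in> set (short T)"

definition nonadj :: "tiling \<Rightarrow> lvert \<Rightarrow> lvert \<Rightarrow> bool" where
  "nonadj T x y \<longleftrightarrow> list_all (\<lambda>z. apart T z y) (nbrs_of T x)"

definition avoids :: "tiling \<Rightarrow> ledge \<Rightarrow> cell \<times> nat \<Rightarrow> bool" where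
  "avoids T x F \<longleftrightarrow> list_all (\<lambda>(off, i). apart T (cadd (fst F) off, i) x) (ftypes T ! snd F)"

text \<open>Faces on the torus are edge sets, so different positions do not make them different. Two
  missing edges separate all three: \<open>e3\<close> is on \<open>F13\<close> and
  \<open>F23\<close> but not on \<open>F12\<close>, and \<open>e2\<close> is on \<open>F23\<close>
  but not on \<open>F13\<close>.\<close>

definition corner_ok :: "tiling \<Rightarrow> nat \<Rightarrow> bool" where
  "corner_ok T k \<longleftrightarrow> (case map fst (star T k) of
     [e1, e2, e3] \<Rightarrow> (\<exists>F12\<in>set (faces_of T e1). \<exists>F13\<in>set (faces_of T e1). \<exists>F23\<in>set (faces_of T e2).
        set (faces_of T e1) = {F12, F13} \<and> set (faces_of T e2) = {F12, F23} \<and>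
        set (faces_of T e3) = {F13, F23} \<and> avoids T e3 F12 \<and> avoids T e2 F13)
   | _ \<Rightarrow> False)"

text \<open>The second list of separations, on the other ends, excludes parallel edges.\<close>

definition star_ok :: "tiling \<Rightarrow> nat \<Rightarrow> bool" where
  "star_ok T k \<longleftrightarrow> length (star T k) = 3 \<and> sorted_wrt (apart T) (map fst (star T k)) \<and>
     sorted_wrt (apart T) (map snd (star T k))"

definition triangle_ok :: "tiling \<Rightarrow> nat \<Rightarrow> bool" where
  "triangle_ok T k \<longleftrightarrow> (\<forall>x\<in>set (nbrs_of T ((0, 0), k)). \<forall>z\<in>set (nbrs_of T ((0, 0), k)).
     x = z \<or> nonadj T x z)"

text \<open>In the next two checks \<open>u = ((0, 0), k)\<close>, \<open>w\<close> is the other end of the deleted edge, \<open>x, x'\<close> are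
  the other neighbours of \<open>u\<close>, and \<open>y, y'\<close> those of \<open>w\<close>.\<close>

definition squares_ok :: "tiling \<Rightarrow> nat \<Rightarrow> bool" where
  "squares_ok T k \<longleftrightarrow> (let N = nbrs_of T ((0, 0), k) in \<forall>w\<in>set N.
     \<forall>x\<in>set N. \<forall>x'\<in>set N. \<forall>y\<in>set (nbrs_of T w). \<forall>y'\<in>set (nbrs_of T w).
       x = x' \<or> x = w \<or> x' = w \<or> y = y' \<or> y = ((0, 0), k) \<or> y' = ((0, 0), k) \<or>
       nonadj T x y \<or> nonadj T x' y')"

definition hexagons_ok :: "tiling \<Rightarrow> nat \<Rightarrow> bool" where
  "hexagons_ok T k \<longleftrightarrow> (let N = nbrs_of T ((0, 0), k) in \<forall>w\<in>set N.
     \<forall>x\<in>set N. \<forall>x'\<in>set N. \<forall>y\<in>set (nbrs_of T w). \<forall>y'\<in>set (nbrs_of T w).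
       x = x' \<or> x = w \<or> x' = w \<or> y = y' \<or> y = ((0, 0), k) \<or> y' = ((0, 0), k) \<or>
       nonadj T x y \<or> (\<forall>q\<in>set (nbrs_of T y'). q = w \<or> q = x \<or> q = x' \<or>
         (\<forall>p\<in>set (nbrs_of T q). p = y \<or> p = y' \<or> nonadj T p x')))"

text \<open>Radius 6 covers the list and stays within the bound 8 of the hypothesis on
  cycles.\<close>

lemma short_reachable: "list_all (\<lambda>d. (d, 0) \<in> set (reach T 6)) (short T)"
  by (cases T; simp only:; code_simp)

lemma star_okI: "k < nloc T \<Longrightarrow> star_ok T k"
proof -
  have "list_all (star_ok T) [0..<nloc T]" by (cases T; simp only:; code_simp)
  then show "k < nloc T \<Longrightarrow> star_ok T k" by (simp add: list_all_iff)
qed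

lemma corner_okI: "k < nloc T \<Longrightarrow> corner_ok T k"
proof -
  have "list_all (corner_ok T) [0..<nloc T]" by (cases T; simp only:; code_simp)
  then show "k < nloc T \<Longrightarrow> corner_ok T k" by (simp add: list_all_iff)
qed

lemma triangle_okI: "k < nloc T \<Longrightarrow> triangle_ok T k"
proof -
  have "list_all (triangle_ok T) [0..<nloc T]" by (cases T; simp only:; code_simp)
  then show "k < nloc T \<Longrightarrow> triangle_ok T k" by (simp add: list_all_iff)
qed

lemma squares_okI: "k < nloc T \<Longrightarrow> squares_ok T k"
proof -
  have "list_all (squares_ok T) [0..<nloc T]" by (cases T; simp only:; code_simp)
  then show "k < nloc T \<Longrightarrow> squares_ok T k" by (simp add: list_all_iff)
qed

text \<open>In 4.6.12 an edge between a square and a hexagon has exactly the configuration that is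
  excluded here.\<close>

lemma hexagons_okI: "T \<noteq> Tiling_4612 \<Longrightarrow> k < nloc T \<Longrightarrow> hexagons_ok T k"
proof -
  assume "T \<noteq> Tiling_4612"
  then have "list_all (hexagons_ok T) [0..<nloc T]" by (cases T; simp only:; code_simp)
  then show "k < nloc T \<Longrightarrow> hexagons_ok T k" by (simp add: list_all_iff)
qed

text \<open>For the six edges of a hexagon to stay distinct on the torus. In the other two tilings
  the sizes of the shrink faces come with the choice of \<open>e\<close>.\<close>

lemma honeycomb_face_ok: "sorted_wrt (apart Honeycomb) (ftypes Honeycomb ! 0)"
  by code_simp

lemma etypes_wf: "(k1, d, k2) \<in> set (etypes T) \<Longrightarrow> k1 < nloc T \<and> k2 < nloc T \<and> k1 \<noteq> k2"
  by (cases T) auto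

lemma ftypes_wf: "F \<in> set (ftypes T) \<Longrightarrow> (off, i) \<in> set F \<Longrightarrow> i < length (etypes T)"
  by (cases T) auto

section \<open>The torus\<close>

lemma cadd_zero [simp]: "cadd p (0, 0) = p" "cadd (0, 0) p = p"
  by (simp_all add: cadd_def)

lemma cadd_assoc: "cadd (cadd p q) r = cadd p (cadd q r)"
  by (simp add: cadd_def)

lemma cadd_commute: "cadd p q = cadd q p"
  by (simp add: cadd_def)

lemma cadd_cneg [simp]: "cadd p (cneg p) = (0, 0)" "cadd (cneg p) p = (0, 0)"
  "cadd p (cadd (cneg p) q) = q" "cadd (cadd q (cneg p)) p = q" "cadd (cadd q p) (cneg p) = q"
  by (simp_all add: cadd_def cneg_def)

lemma in_set_star:
  "((o', i), (d, l)) \<in> set (star T k) \<longleftrightarrow> (\<exists>k1 d0 k2. i < length (etypes T) \<and>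
     etypes T ! i = (k1, d0, k2) \<and>
     (k1 = k \<and> o' = (0, 0) \<and> d = d0 \<and> l = k2 \<or> k2 = k \<and> o' = cneg d0 \<and> d = cneg d0 \<and> l = k1))"
  (is "?L \<longleftrightarrow> ?R")
proof
  assume ?L
  then show ?R unfolding star_def by (auto simp: in_set_enumerate_eq split: if_splits)
next
  assume ?R
  then obtain k1 d0 k2 where *: "i < length (etypes T)" "etypes T ! i = (k1, d0, k2)"
     "k1 = k \<and> o' = (0, 0) \<and> d = d0 \<and> l = k2 \<or> k2 = k \<and> o' = cneg d0 \<and> d = cneg d0 \<and> l = k1"
    by blast
  then have "(i, k1, d0, k2) \<in> set (enumerate 0 (etypes T))" by (simp add: in_set_enumerate_eq)
  then show ?L unfolding star_def using *(3)
    by (cases d0) (auto intro!: bexI[of _ "(i, k1, d0, k2)"])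
qed

lemma in_set_faces_of:
  "F \<in> set (faces_of T x) \<longleftrightarrow> (\<exists>off. snd F < length (ftypes T) \<and>
     (off, snd x) \<in> set (ftypes T ! snd F) \<and> fst F = cadd (fst x) (cneg off))"
  (is "?L \<longleftrightarrow> ?R")
proof -
  have "?L \<longleftrightarrow> (\<exists>j<length (ftypes T). \<exists>y\<in>set (ftypes T ! j).
      snd y = snd x \<and> F = (cadd (fst x) (cneg (fst y)), j))"
    using [[simproc del: list_to_set_comprehension]]
    unfolding faces_of_def by (auto simp: Bex_def split: if_splits)
  also have "\<dots> \<longleftrightarrow> ?R"
  proof
    assume "\<exists>j<length (ftypes T). \<exists>y\<in>set (ftypes T ! j).
      snd y = snd x \<and> F = (cadd (fst x) (cneg (fst y)), j)"
    then show ?R by (metis fst_conv snd_conv prod.collapse)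
  next
    assume ?R
    then obtain off where "snd F < length (ftypes T)" "(off, snd x) \<in> set (ftypes T ! snd F)"
      "F = (cadd (fst x) (cneg off), snd F)" by (metis prod.collapse)
    then show "\<exists>j<length (ftypes T). \<exists>y\<in>set (ftypes T ! j).
        snd y = snd x \<and> F = (cadd (fst x) (cneg (fst y)), j)" by (metis fst_conv snd_conv)
  qed
  finally show ?thesis .
qed

lemma etypes_nth_wf:
  "i < length (etypes T) \<Longrightarrow> etypes T ! i = (k1, d, k2) \<Longrightarrow> k1 < nloc T \<and> k2 < nloc T \<and> k1 \<noteq> k2"
  using etypes_wf[of k1 d k2 T] by (metis nth_mem)

lemma star_wf:
  assumes "((o', i), (d, l)) \<in> set (star T k)"
  shows "i < length (etypes T)" "l < nloc T" "l \<noteq> k"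
proof -
  obtain k1 d0 k2 where "i < length (etypes T)" "etypes T ! i = (k1, d0, k2)"
    "k1 = k \<and> l = k2 \<or> k2 = k \<and> l = k1"
    using assms unfolding in_set_star by blast
  then show "i < length (etypes T)" "l < nloc T" "l \<noteq> k"
    using etypes_nth_wf[of i T k1 d0 k2] by auto
qed

lemma plane_ends_star:
  assumes "((o', i), (d, l)) \<in> set (star T k)"
  shows "plane_ends T (cadd p o', i) = {(p, k), (cadd p d, l)}"
  using assms unfolding in_set_star plane_ends_def by auto

locale torus =
  fixes T :: tiling and a b c :: int
  assumes a: "a > 0" and c: "c > 0"
begin

abbreviation G :: "(lvert, ledge) ccg" where "G \<equiv> torus_lattice T a b c"

abbreviation rd :: "cell \<Rightarrow> cell" where "rd \<equiv> red a b c"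

lemma red_eq_iff:
  "rd p = rd q \<longleftrightarrow> (\<exists>s t. fst p = fst q + a * s + b * t \<and> snd p = snd q + c * t)"
proof
  assume "rd p = rd q"
  then have 1: "(fst p - b * (snd p div c)) mod a = (fst q - b * (snd q div c)) mod a"
    and 2: "snd p mod c = snd q mod c" unfolding red_def by (auto simp: Let_def)
  have "a dvd fst p - b * (snd p div c) - (fst q - b * (snd q div c))"
    using 1 by (simp only: mod_eq_dvd_iff)
  then obtain s where "fst p - b * (snd p div c) - (fst q - b * (snd q div c)) = a * s"
    by (rule dvdE)
  \<comment> \<open>The coefficient \<open>t\<close> of the second basis vector is the difference of
    the quotients by \<open>c\<close>; \<open>s\<close> is what then remains of the first
    coordinate, divided by \<open>a\<close>.\<close>
  moreover have "snd p = snd q + c * (snd p div c - snd q div c)"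
    unfolding right_diff_distrib
    using 2 mult_div_mod_eq[of c "snd p"] mult_div_mod_eq[of c "snd q"] by linarith
  ultimately show "\<exists>s t. fst p = fst q + a * s + b * t \<and> snd p = snd q + c * t"
    by (intro exI[of _ s] exI[of _ "snd p div c - snd q div c"]) (simp add: algebra_simps)
next
  assume "\<exists>s t. fst p = fst q + a * s + b * t \<and> snd p = snd q + c * t"
  then obtain s t where st: "fst p = fst q + a * s + b * t" "snd p = snd q + c * t" by blast
  have "snd p div c = snd q div c + t" using c st by simp
  then have "fst p - b * (snd p div c) = (fst q - b * (snd q div c)) + a * s"
    using st by (simp add: algebra_simps)
  then have "(fst p - b * (snd p div c)) mod a = (fst q - b * (snd q div c)) mod a"
    by (simp only: mod_mult_self2)
  then show "rd p = rd q" unfolding red_def using st(2) by (simp only: Let_def mod_mult_self2)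
qed

lemma red_in_cells [simp]: "rd p \<in> cells a c"
  using a c unfolding red_def cells_def by (simp add: Let_def)

lemma red_cells: "p \<in> cells a c \<Longrightarrow> rd p = p"
  unfolding red_def cells_def by (auto simp: Let_def)

lemma red_red [simp]: "rd (rd p) = rd p"
  by (rule red_cells) simp

lemma red_cadd_cancel: "rd (cadd p d) = rd (cadd q d) \<longleftrightarrow> rd p = rd q"
  unfolding red_eq_iff cadd_def by (simp add: algebra_simps)

lemma red_cadd_red [simp]: "rd (cadd (rd p) d) = rd (cadd p d)"
  by (simp add: red_cadd_cancel)

text \<open>The point of the torus at position \<open>r\<close> relative to the base cell \<open>q\<close>.\<close>

definition place :: "cell \<Rightarrow> cell \<times> nat \<Rightarrow> cell \<times> nat" where
  "place q r = (rd (cadd q (fst r)), snd r)"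

lemma place_red [simp]: "place (rd q) r = place q r"
  by (simp add: place_def)

lemma ends_proj: "ends G (proj a b c x) = proj a b c ` plane_ends T x"
  unfolding torus_lattice_def proj_def plane_ends_def
  by (auto split: prod.split)

lemma ends_place_star:
  assumes "((o', i), (d, l)) \<in> set (star T k)"
  shows "ends G (place q (o', i)) = {place q ((0, 0), k), place q (d, l)}"
  using ends_proj[of "(cadd q o', i)"] plane_ends_star[OF assms, of q]
  unfolding place_def proj_def by auto

lemma place_in_edges: "i < length (etypes T) \<Longrightarrow> place q (o', i) \<in> edges G"
  unfolding torus_lattice_def place_def by simp

lemma place_in_verts: "snd r < nloc T \<Longrightarrow> place q r \<in> verts G"
  unfolding torus_lattice_def place_def by simp

lemma incident_star:
  assumes f: "f \<in> edges G" "place q ((0, 0), k) \<in> ends G f"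
  obtains o' i d l where "((o', i), (d, l)) \<in> set (star T k)" "f = place q (o', i)"
proof -
  obtain p i where pi: "f = (p, i)" "p \<in> cells a c" "i < length (etypes T)"
    using f(1) unfolding torus_lattice_def by auto
  obtain k1 d k2 where e: "etypes T ! i = (k1, d, k2)" by (cases "etypes T ! i")
  have "(rd q, k) = (p, k1) \<or> (rd q, k) = (rd (cadd p d), k2)"
    using f(2) pi(1) e unfolding torus_lattice_def place_def by auto
  then show ?thesis
  proof
    assume "(rd q, k) = (p, k1)"
    then show ?thesis using that[of "(0, 0)" i d k2] pi e unfolding in_set_star place_def by auto
  next
    assume *: "(rd q, k) = (rd (cadd p d), k2)"
    then have "rd (cadd q (cneg d)) = rd (cadd (cadd p d) (cneg d))" unfolding red_cadd_cancel by simp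
    then have "rd (cadd q (cneg d)) = p" using pi red_cells by simp
    then show ?thesis using that[of "cneg d" i "cneg d" k1] * pi e unfolding in_set_star place_def by auto
  qed
qed

lemma incident_edges:
  assumes "k < nloc T"
  shows "{f \<in> edges G. place q ((0, 0), k) \<in> ends G f} = place q ` set (map fst (star T k))"
proof (intro set_eqI iffI)
  fix f assume "f \<in> {f \<in> edges G. place q ((0, 0), k) \<in> ends G f}"
  then obtain o' i d l where "((o', i), (d, l)) \<in> set (star T k)" "f = place q (o', i)"
    using incident_star by blast
  then show "f \<in> place q ` set (map fst (star T k))" by force
next
  fix f assume "f \<in> place q ` set (map fst (star T k))"
  then obtain o' i d l where *: "((o', i), (d, l)) \<in> set (star T k)" "f = place q (o', i)" by auto
  then show "f \<in> {f \<in> edges G. place q ((0, 0), k) \<in> ends G f}"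
    using ends_place_star[OF *(1), of q] star_wf[OF *(1)] place_in_edges by auto
qed

lemma place_cadd: "place (cadd q p) (d, l) = place q (cadd p d, l)"
  by (simp add: place_def cadd_assoc)

text \<open>Every step on the torus lifts to a plane step from the chosen position. Through this,
  walks are lifted and plane checks descend.\<close>

lemma cc_adj_place:
  assumes "snd r < nloc T"
  shows "cc_adj G (place q r) v \<longleftrightarrow> (\<exists>s\<in>set (nbrs_of T r). v = place q s)"
proof -
  obtain p k where r: "r = (p, k)" by (cases r)
  \<comment> \<open>\<open>star\<close> knows only vertices in the base cell, so the cell of
    \<open>r\<close> is made the base.\<close>
  define q' where "q' = cadd q p"
  have pr: "place q r = place q' ((0, 0), k)" unfolding q'_def place_cadd r by simp
  have "cc_adj G (place q' ((0, 0), k)) v \<longleftrightarrow>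
    (\<exists>o' i d l. ((o', i), (d, l)) \<in> set (star T k) \<and> v = place q' (d, l))"
  proof
    assume "cc_adj G (place q' ((0, 0), k)) v"
    then obtain f where f: "f \<in> edges G" "ends G f = {place q' ((0, 0), k), v}"
      "v \<noteq> place q' ((0, 0), k)" unfolding cc_adj_def by auto
    then obtain o' i d l where *: "((o', i), (d, l)) \<in> set (star T k)" "f = place q' (o', i)"
      using incident_star[of f q' k] by blast
    then have "v = place q' (d, l)" using f ends_place_star[OF *(1), of q']
      by (metis doubleton_eq_iff)
    then show "\<exists>o' i d l. ((o', i), (d, l)) \<in> set (star T k) \<and> v = place q' (d, l)" using * by blast
  next
    assume "\<exists>o' i d l. ((o', i), (d, l)) \<in> set (star T k) \<and> v = place q' (d, l)"
    then obtain o' i d l where *: "((o', i), (d, l)) \<in> set (star T k)" "v = place q' (d, l)" by blast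
    have "place q' ((0, 0), k) \<noteq> v" using star_wf[OF *(1)] * by (auto simp: place_def)
    moreover have "place q' (o', i) \<in> edges G" "ends G (place q' (o', i)) = {place q' ((0, 0), k), v}"
      using star_wf[OF *(1)] ends_place_star[OF *(1), of q'] *(2) place_in_edges by auto
    moreover have "place q' ((0, 0), k) \<in> verts G" "v \<in> verts G"
      using star_wf[OF *(1)] *(2) assms r place_in_verts by auto
    ultimately show "cc_adj G (place q' ((0, 0), k)) v" unfolding cc_adj_def by blast
  qed
  also have "\<dots> \<longleftrightarrow> (\<exists>s\<in>set (nbrs_of T r). v = place q s)"
    unfolding nbrs_of_def r q'_def place_cadd by force
  finally show ?thesis unfolding pr .
qed

lemma nbrs_of_wf: "s \<in> set (nbrs_of T r) \<Longrightarrow> snd s < nloc T"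
  unfolding nbrs_of_def using star_wf by auto

lemma verts_place: "v \<in> verts G \<Longrightarrow> \<exists>q k. v = place q ((0, 0), k) \<and> k < nloc T"
proof -
  assume "v \<in> verts G"
  then obtain q k where "v = (q, k)" "q \<in> cells a c" "k < nloc T" unfolding torus_lattice_def by auto
  then show ?thesis using red_cells unfolding place_def by (intro exI[of _ q] exI[of _ k]) simp
qed

lemma face_set_place: "face_set T a b c q j = place q ` set (ftypes T ! j)"
  unfolding face_set_def place_def by (intro image_cong) auto

lemma face_set_red: "rd q = rd q' \<Longrightarrow> face_set T a b c q j = face_set T a b c q' j"
proof -
  assume "rd q = rd q'"
  then have "place q = place q'" by (metis place_red ext)
  then show ?thesis unfolding face_set_place by simp
qed

lemma faces_torus:
  "faces G = {face_set T a b c q j | q j. q \<in> cells a c \<and> j < length (ftypes T)}"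
  by (simp add: torus_lattice_def)

text \<open>The edge determines the cell of the face up to a period once the offset is subtracted,
  and the face as an edge set depends only on that class.\<close>

lemma faces_at_place:
  "faces_at G (place q x) = (\<lambda>(p, j). face_set T a b c (cadd q p) j) ` set (faces_of T x)"
proof (intro set_eqI iffI)
  fix S assume "S \<in> faces_at G (place q x)"
  then obtain q' j where S: "S = face_set T a b c q' j" "j < length (ftypes T)" "place q x \<in> S"
    unfolding faces_at_def torus_lattice_def by auto
  then obtain off where off: "(off, snd x) \<in> set (ftypes T ! j)"
    "rd (cadd q (fst x)) = rd (cadd q' off)"
    unfolding face_set_place by (auto simp: place_def)
  then have "rd (cadd (cadd q (fst x)) (cneg off)) = rd (cadd (cadd q' off) (cneg off))"
    unfolding red_cadd_cancel by simp
  then have "rd q' = rd (cadd q (cadd (fst x) (cneg off)))" by (simp add: cadd_assoc)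
  then have "S = face_set T a b c (cadd q (cadd (fst x) (cneg off))) j"
    unfolding S(1) by (rule face_set_red)
  moreover have "(cadd (fst x) (cneg off), j) \<in> set (faces_of T x)"
    unfolding in_set_faces_of using off(1) S(2) by (intro exI[of _ off]) simp
  ultimately show "S \<in> (\<lambda>(p, j). face_set T a b c (cadd q p) j) ` set (faces_of T x)" by force
next
  fix S assume "S \<in> (\<lambda>(p, j). face_set T a b c (cadd q p) j) ` set (faces_of T x)"
  then obtain j off where j: "j < length (ftypes T)" "(off, snd x) \<in> set (ftypes T ! j)"
    "S = face_set T a b c (cadd q (cadd (fst x) (cneg off))) j"
    by (auto simp: in_set_faces_of)
  have "S = face_set T a b c (rd (cadd q (cadd (fst x) (cneg off)))) j"
    unfolding j(3) by (rule face_set_red) simp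
  then have "S \<in> faces G" unfolding faces_torus using j(1) red_in_cells by blast
  moreover have "place q x = place (cadd q (cadd (fst x) (cneg off))) (off, snd x)"
    unfolding place_def by (simp add: cadd_assoc)
  then have "place q x \<in> S" unfolding j(3) face_set_place using j(2) by blast
  ultimately show "S \<in> faces_at G (place q x)" unfolding faces_at_def by simp
qed

end

section \<open>Short plane paths do not join points that differ by a period\<close>

locale large_torus = torus +
  assumes large: "\<forall>vs es. is_cycle (torus_lattice T a b c) vs es \<and> \<not> contractible T a b c vs es
                  \<longrightarrow> length es > 8"
begin

text \<open>Functions of the index instead of lists, so that restricting a path or cutting out a
  stretch is a shift of the argument.\<close>

definition plane_path :: "(nat \<Rightarrow> lvert) \<Rightarrow> (nat \<Rightarrow> ledge) \<Rightarrow> nat \<Rightarrow> bool" where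
  "plane_path P Q n \<longleftrightarrow>
     (\<forall>i<n. snd (Q i) < length (etypes T) \<and> plane_ends T (Q i) = {P i, P (Suc i)})"

lemma plane_edge_cases:
  assumes "i < length (etypes T)" "plane_ends T (p, i) = {x, y}"
  obtains k1 d k2 where "etypes T ! i = (k1, d, k2)" "k1 \<noteq> k2" "k1 < nloc T" "k2 < nloc T"
    "x = (p, k1) \<and> y = (cadd p d, k2) \<or> y = (p, k1) \<and> x = (cadd p d, k2)"
proof -
  obtain k1 d k2 where e: "etypes T ! i = (k1, d, k2)" by (cases "etypes T ! i")
  show ?thesis
    using that[OF e] assms etypes_nth_wf[OF assms(1) e] e
    unfolding plane_ends_def by (auto simp: doubleton_eq_iff)
qed

lemma proj_verts: "snd x < nloc T \<Longrightarrow> proj a b c x \<in> verts G"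
  unfolding torus_lattice_def proj_def by simp

text \<open>Distinct vertices leave one way to repeat an edge, namely going along it and straight
  back. Such a path also closes in the plane, contrary to \<open>P 0\<close> and \<open>P n\<close>
  being different.\<close>

lemma simple_path_cycle:
  assumes path: "plane_path P Q n" and n: "n > 0"
    and closed: "proj a b c (P 0) = proj a b c (P n)" "P 0 \<noteq> P n"
    and simple: "\<And>i j. i < j \<Longrightarrow> j \<le> n \<Longrightarrow> (i, j) \<noteq> (0, n) \<Longrightarrow> proj a b c (P i) \<noteq> proj a b c (P j)"
  shows "is_cycle G (map (proj a b c \<circ> P) [0..<Suc n]) (map (proj a b c \<circ> Q) [0..<n])"
proof -
  have Q: "snd (Q i) < length (etypes T)" "plane_ends T (Q i) = {P i, P (Suc i)}" if "i < n" for i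
    using path that unfolding plane_path_def by auto
  have ends: "ends G (proj a b c (Q i)) = {proj a b c (P i), proj a b c (P (Suc i))}" if "i < n" for i
    unfolding ends_proj Q(2)[OF that] by simp
  have loc: "snd (P i) < nloc T" if i: "i \<le> n" for i
  proof -
    obtain j where j: "j < n" "i = j \<or> i = Suc j"
      using i n by (intro that[of "i - 1"]) auto
    obtain p t where pt: "Q j = (p, t)" by (cases "Q j")
    show ?thesis
      using plane_edge_cases[of t p "P j" "P (Suc j)"] Q[OF j(1)] j(2) pt by (metis snd_conv)
  qed
  have inj: "inj_on (proj a b c \<circ> P) {0..<n}"
  proof (rule linorder_inj_onI)
    fix i j assume "i < j" "i \<in> {0..<n}" "j \<in> {0..<n}"
    then show "(proj a b c \<circ> P) i \<noteq> (proj a b c \<circ> P) j" using simple[of i j] by simp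
  qed auto
  have injQ: "inj_on (proj a b c \<circ> Q) {0..<n}"
  proof (rule linorder_inj_onI)
    fix i j assume ij: "i < j" "i \<in> {0..<n}" "j \<in> {0..<n}"
    show "(proj a b c \<circ> Q) i \<noteq> (proj a b c \<circ> Q) j"
    proof
      assume eq: "(proj a b c \<circ> Q) i = (proj a b c \<circ> Q) j"
      then have "{proj a b c (P i), proj a b c (P (Suc i))} = {proj a b c (P j), proj a b c (P (Suc j))}"
        using ends[of i] ends[of j] ij by simp
      moreover have "proj a b c (P i) \<noteq> proj a b c (P j)" using simple[of i j] ij by simp
      ultimately have 1: "proj a b c (P i) = proj a b c (P (Suc j))"
        "proj a b c (P (Suc i)) = proj a b c (P j)" by (auto simp: doubleton_eq_iff)
      \<comment> \<open>A repeated edge is traversed in opposite directions. The only permitted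
        coincidence of vertices is that of the two ends of the path, so the path has length
        2.\<close>
      have "(i, Suc j) = (0, n)" using simple[of i "Suc j"] 1(1) ij by force
      then have "i = 0" "Suc j = n" by auto
      moreover have "j = Suc i" using simple[of "Suc i" j] 1 ij by (cases "Suc i < j") auto
      ultimately have n2: "n = 2" "i = 0" "j = 1" by auto
      obtain p t where pt: "Q 0 = (p, t)" by (cases "Q 0")
      obtain p' where pt': "Q 1 = (p', t)" using eq n2 pt by (cases "Q 1") (auto simp: proj_def)
      have t: "t < length (etypes T)" "plane_ends T (p, t) = {P 0, P 1}"
        "plane_ends T (p', t) = {P 1, P 2}"
        using Q[of 0] Q[of 1] n2 pt pt' by (auto simp: numeral_2_eq_2)
      obtain k1 d k2 where e: "etypes T ! t = (k1, d, k2)" "k1 \<noteq> k2"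
        and o1: "P 0 = (p, k1) \<and> P 1 = (cadd p d, k2) \<or> P 1 = (p, k1) \<and> P 0 = (cadd p d, k2)"
        using plane_edge_cases[OF t(1,2)] by metis
      have o2: "P 1 = (p', k1) \<and> P 2 = (cadd p' d, k2) \<or> P 2 = (p', k1) \<and> P 1 = (cadd p' d, k2)"
        using plane_edge_cases[OF t(1,3)] e(1) by (metis prod.inject)
      have "P 0 = P 2" using o1 o2 e(2) by (auto simp: cadd_def prod_eq_iff)
      then show False using closed n2 by simp
    qed
  qed auto
  show ?thesis
    unfolding is_cycle_def
  proof (intro conjI allI impI)
    show "map (proj a b c \<circ> Q) [0..<n] \<noteq> []" using n by simp
    show "hd (map (proj a b c \<circ> P) [0..<Suc n]) = last (map (proj a b c \<circ> P) [0..<Suc n])"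
      using closed by (simp add: hd_map del: upt_Suc) (simp add: last_map)
    show "distinct (butlast (map (proj a b c \<circ> P) [0..<Suc n]))"
      using inj by (simp add: distinct_map)
    show "distinct (map (proj a b c \<circ> Q) [0..<n])" using injQ by (simp add: distinct_map)
    show "set (map (proj a b c \<circ> Q) [0..<n]) \<subseteq> edges G"
      using Q(1) unfolding torus_lattice_def proj_def by auto
    show "set (map (proj a b c \<circ> P) [0..<Suc n]) \<subseteq> verts G"
    proof
      fix x assume "x \<in> set (map (proj a b c \<circ> P) [0..<Suc n])"
      then obtain i where "i \<le> n" "x = proj a b c (P i)" by (auto simp: less_Suc_eq_le simp del: upt_Suc)
      then show "x \<in> verts G" using loc proj_verts by blast
    qed
    fix i assume "i < length (map (proj a b c \<circ> Q) [0..<n])"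
    then show "ends G (map (proj a b c \<circ> Q) [0..<n] ! i) =
      {map (proj a b c \<circ> P) [0..<Suc n] ! i, map (proj a b c \<circ> P) [0..<Suc n] ! Suc i}"
      using ends[of i] by (simp del: upt_Suc)
  qed simp
qed

text \<open>Lifts of a walk are unique up to translation.\<close>

lemma open_path_not_contractible:
  assumes path: "plane_path P Q n" and neq: "P 0 \<noteq> P n"
  shows "\<not> contractible T a b c (map (proj a b c \<circ> P) [0..<Suc n]) (map (proj a b c \<circ> Q) [0..<n])"
proof
  assume "contractible T a b c (map (proj a b c \<circ> P) [0..<Suc n]) (map (proj a b c \<circ> Q) [0..<n])"
  then obtain ps qs where len: "length ps = Suc n" "length qs = n" and cl: "hd ps = last ps"
    and ps: "\<And>i. i < Suc n \<Longrightarrow> proj a b c (ps ! i) = proj a b c (P i)"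
    and qs: "\<And>i. i < n \<Longrightarrow> proj a b c (qs ! i) = proj a b c (Q i)"
    and pe: "\<And>i. i < n \<Longrightarrow> plane_ends T (qs ! i) = {ps ! i, ps ! Suc i}"
    unfolding contractible_def by (auto simp del: upt_Suc)
  \<comment> \<open>The translation that carries \<open>P\<close> to the other lift, read off at the
    starting points.\<close>
  define m where "m = cadd (fst (ps ! 0)) (cneg (fst (P 0)))"
  have "ps ! i = (cadd (fst (P i)) m, snd (P i))" if "i \<le> n" for i
    using that
  proof (induction i)
    case 0
    show ?case using ps[of 0] unfolding m_def proj_def by (auto simp: cadd_def cneg_def prod_eq_iff)
  next
    case (Suc i)
    then have i: "i < n" and IH: "ps ! i = (cadd (fst (P i)) m, snd (P i))" by auto
    obtain p t where pt: "Q i = (p, t)" by (cases "Q i")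
    obtain p' where pt': "qs ! i = (p', t)" using qs[OF i] pt by (cases "qs ! i") (auto simp: proj_def)
    have t: "t < length (etypes T)" "plane_ends T (p, t) = {P i, P (Suc i)}"
      using path i pt unfolding plane_path_def by auto
    obtain k1 d k2 where e: "etypes T ! t = (k1, d, k2)" "k1 \<noteq> k2"
      and o1: "P i = (p, k1) \<and> P (Suc i) = (cadd p d, k2) \<or> P (Suc i) = (p, k1) \<and> P i = (cadd p d, k2)"
      using plane_edge_cases[OF t] by metis
    have "plane_ends T (p', t) = {ps ! i, ps ! Suc i}" using pe[OF i] pt' by simp
    \<comment> \<open>As \<open>k1\<close> and \<open>k2\<close> differ, the type of the common end
      tells in which direction the edge is traversed, so both lifts make the same move.\<close>
    then have o2: "ps ! i = (p', k1) \<and> ps ! Suc i = (cadd p' d, k2) \<or>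
        ps ! Suc i = (p', k1) \<and> ps ! i = (cadd p' d, k2)"
      using plane_edge_cases[OF t(1), of p' "ps ! i" "ps ! Suc i"] e(1) by (metis prod.inject)
    obtain y k where "P i = (y, k)" by (cases "P i")
    then show ?case using o1 o2 e(2) IH by (auto simp: cadd_def)
  qed
  moreover have "hd ps = ps ! 0" "last ps = ps ! n"
    using len by (auto simp: hd_conv_nth last_conv_nth simp flip: length_0_conv)
  ultimately have "cadd (fst (P 0)) m = cadd (fst (P n)) m" "snd (P 0) = snd (P n)"
    using cl by auto
  then show False using neq by (auto simp: cadd_def prod_eq_iff)
qed

text \<open>A shortest counterexample projects to a cycle on the torus, since at a repeated vertex it
  could be cut.\<close>

lemma non_contractible_path_long:
  "plane_path P Q n \<Longrightarrow> proj a b c (P 0) = proj a b c (P n) \<Longrightarrow> P 0 \<noteq> P n \<Longrightarrow> n > 8"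
proof (induction n arbitrary: P Q rule: less_induct)
  case (less n)
  have n: "n > 0" using less.prems(3) by (cases n) auto
  show ?case
  proof (cases "\<exists>i j. i < j \<and> j \<le> n \<and> (i, j) \<noteq> (0, n) \<and> proj a b c (P i) = proj a b c (P j)")
    case True
    then obtain i j where ij: "i < j" "j \<le> n" "(i, j) \<noteq> (0, n)"
      and pij: "proj a b c (P i) = proj a b c (P j)" by blast
    \<comment> \<open>If the stretch from \<open>i\<close> to \<open>j\<close> is open in the plane,
      it is itself a shorter counterexample; if it is closed, removing it leaves one.\<close>
    show ?thesis
    proof (cases "P i = P j")
      case False
      have "plane_path (\<lambda>t. P (t + i)) (\<lambda>t. Q (t + i)) (j - i)"
        using less.prems(1) ij unfolding plane_path_def by auto
      then have "8 < j - i"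
        using less.IH[of "j - i" "\<lambda>t. P (t + i)" "\<lambda>t. Q (t + i)"] ij pij False by auto
      then show ?thesis using ij by simp
    next
      case True
      define P' Q' where "P' = (\<lambda>t. if t \<le> i then P t else P (t + (j - i)))"
        and "Q' = (\<lambda>t. if t < i then Q t else Q (t + (j - i)))"
      have "plane_path P' Q' (n - (j - i))"
        unfolding plane_path_def
      proof (intro allI impI)
        fix t assume t: "t < n - (j - i)"
        show "snd (Q' t) < length (etypes T) \<and> plane_ends T (Q' t) = {P' t, P' (Suc t)}"
        proof (cases "t = i")
          case True
          then show ?thesis
            using less.prems(1)[unfolded plane_path_def, rule_format, of j] \<open>P i = P j\<close> t ij
            unfolding P'_def Q'_def by auto
        next
          case False
          then show ?thesis
            using less.prems(1)[unfolded plane_path_def, rule_format, of t]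
              less.prems(1)[unfolded plane_path_def, rule_format, of "t + (j - i)"] t ij
            unfolding P'_def Q'_def by auto
        qed
      qed
      moreover have "P' 0 = P 0" unfolding P'_def by simp
      moreover have "P' (n - (j - i)) = P n"
        using ij True unfolding P'_def by (cases "j = n") auto
      ultimately have "8 < n - (j - i)"
        using less.IH[of "n - (j - i)" P' Q'] less.prems ij by auto
      then show ?thesis by simp
    qed
  next
    case False
    then have "is_cycle G (map (proj a b c \<circ> P) [0..<Suc n]) (map (proj a b c \<circ> Q) [0..<n])"
      using simple_path_cycle[OF less.prems(1) n less.prems(2,3)] by blast
    then have "length (map (proj a b c \<circ> Q) [0..<n]) > 8"
      using large open_path_not_contractible[OF less.prems(1,3)] by blast
    then show ?thesis by simp
  qed
qed

lemma reach_path: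
  "r \<in> set (reach T n) \<Longrightarrow> \<exists>m\<le>n. \<exists>P Q. plane_path P Q m \<and> P 0 = ((0, 0), 0) \<and> P m = r"
proof (induction n arbitrary: r)
  case 0
  then show ?case
    by (intro exI[of _ 0] conjI exI[of _ "\<lambda>_. ((0, 0), 0)"]) (auto simp: plane_path_def)
next
  case (Suc n)
  then consider "r \<in> set (reach T n)" | s where "s \<in> set (reach T n)" "r \<in> set (nbrs_of T s)" by auto
  then show ?case
  proof cases
    case 1
    then show ?thesis using Suc.IH[of r] le_SucI by blast
  next
    case 2
    then obtain m P Q where P: "m \<le> n" "plane_path P Q m" "P 0 = ((0, 0), 0)" "P m = s"
      using Suc.IH[of s] by blast
    obtain o' i d l where *: "((o', i), (d, l)) \<in> set (star T (snd s))" "r = (cadd (fst s) d, l)"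
      using 2(2) unfolding nbrs_of_def by auto
    define P' Q' where "P' = P(Suc m := r)" and "Q' = Q(m := (cadd (fst s) o', i))"
    have "plane_ends T (cadd (fst s) o', i) = {s, r}"
      using plane_ends_star[OF *(1), of "fst s"] *(2) by simp
    then have "plane_path P' Q' (Suc m)"
      using P star_wf[OF *(1)] unfolding plane_path_def P'_def Q'_def by (auto simp: less_Suc_eq)
    moreover have "P' 0 = ((0, 0), 0)" "P' (Suc m) = r" using P unfolding P'_def by auto
    moreover have "Suc m \<le> Suc n" using P(1) by simp
    ultimately show ?thesis by blast
  qed
qed

text \<open>If \<open>d\<close> were a period, the path of length at most 6 to \<open>(d, 0)\<close>
  would close up on the torus but not in the plane.\<close>

lemma short_not_period:
  assumes "d \<in> set (short T)"
  shows "rd d \<noteq> rd (0, 0)"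
proof
  assume eq: "rd d = rd (0, 0)"
  have "(d, 0) \<in> set (reach T 6)" using short_reachable[of T] assms by (simp add: list_all_iff)
  then obtain m P Q where "m \<le> 6" "plane_path P Q m" "P 0 = ((0, 0), 0)" "P m = (d, 0)"
    using reach_path by blast
  moreover have "d \<noteq> (0, 0)" using assms by (cases T) auto
  ultimately show False using non_contractible_path_long[of P Q m] eq by (auto simp: proj_def)
qed

lemma apart_place:
  assumes "apart T x y"
  shows "place q x \<noteq> place q y"
proof
  assume eq: "place q x = place q y"
  have *: "rd (cadd (fst x) (cneg (fst y))) = rd (0, 0)" if "place q x = place q y" for x y
  proof -
    have "rd (cadd (fst x) q) = rd (cadd (fst y) q)" using that by (simp add: place_def cadd_commute)
    then have "rd (cadd (fst x) (cneg (fst y))) = rd (cadd (fst y) (cneg (fst y)))"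
      unfolding red_cadd_cancel .
    then show ?thesis by simp
  qed
  have "snd x = snd y" using eq by (simp add: place_def)
  then show False using assms *[OF eq] *[OF eq[symmetric]] short_not_period unfolding apart_def by blast
qed

lemma sorted_apart_distinct: "sorted_wrt (apart T) xs \<Longrightarrow> distinct (map (place q) xs)"
  by (induction xs) (auto dest: apart_place)

lemma nonadj_place:
  assumes "nonadj T x y" "snd x < nloc T"
  shows "\<not> cc_adj G (place q x) (place q y)"
  using assms apart_place unfolding cc_adj_place[OF assms(2)] nonadj_def list_all_iff by metis

lemma avoids_place:
  assumes "avoids T x (p, j)"
  shows "place q x \<notin> face_set T a b c (cadd q p) j"
proof
  assume "place q x \<in> face_set T a b c (cadd q p) j"
  then obtain y where y: "y \<in> set (ftypes T ! j)" "place q x = place (cadd q p) y"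
    unfolding face_set_place by blast
  obtain off i where oi: "y = (off, i)" by (cases y)
  have "apart T (cadd p off, i) x" using assms y(1) oi unfolding avoids_def list_all_iff by auto
  then show False using apart_place[of "(cadd p off, i)" x q] y(2) oi place_cadd[of q p off i] by simp
qed

end

section \<open>The torus lattice as a cubic cell graph, and its short cycles\<close>

context large_torus
begin

lemma corner_torus:
  assumes v: "v \<in> verts G"
  shows "\<exists>e1 e2 e3 F12 F13 F23. is_corner G v e1 e2 e3 F12 F13 F23"
proof -
  obtain q k where v: "v = place q ((0, 0), k)" and k: "k < nloc T" using verts_place[OF v] by blast
  have sok: "length (map fst (star T k)) = 3" "sorted_wrt (apart T) (map fst (star T k))"
    using star_okI[OF k] unfolding star_ok_def by auto
  then obtain e1 e2 e3 where es: "map fst (star T k) = [e1, e2, e3]"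
    by (auto simp: length_Suc_conv numeral_3_eq_3)
  have dist: "distinct (map (place q) [e1, e2, e3])"
    using sorted_apart_distinct[OF sok(2), of q] es by simp
  obtain F12 F13 F23 where F: "set (faces_of T e1) = {F12, F13}" "set (faces_of T e2) = {F12, F23}"
    "set (faces_of T e3) = {F13, F23}" and av: "avoids T e3 F12" "avoids T e2 F13"
    using corner_okI[OF k] unfolding corner_ok_def es by auto
  define S where "S = (\<lambda>(p, j). face_set T a b c (cadd q p) j)"
  have at: "faces_at G (place q e1) = {S F12, S F13}" "faces_at G (place q e2) = {S F12, S F23}"
    "faces_at G (place q e3) = {S F13, S F23}"
    unfolding faces_at_place F S_def by simp_all
  have "place q e3 \<notin> S F12" "place q e2 \<notin> S F13"
    using av avoids_place unfolding S_def by (cases F12, simp, cases F13, simp)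
  moreover have "place q e3 \<in> S F13" "place q e3 \<in> S F23" "place q e2 \<in> S F23"
    using at unfolding faces_at_def by blast+
  ultimately have "S F12 \<noteq> S F13" "S F12 \<noteq> S F23" "S F13 \<noteq> S F23" by auto
  moreover have "{f \<in> edges G. v \<in> ends G f} = {place q e1, place q e2, place q e3}"
    unfolding v incident_edges[OF k] es by simp
  ultimately have "is_corner G v (place q e1) (place q e2) (place q e3) (S F12) (S F13) (S F23)"
    unfolding is_corner_def using at dist by simp
  then show ?thesis by blast
qed

text \<open>Two edges with the same ends would lead from one vertex to the same neighbour, but the
  three neighbour positions of a vertex stay apart on the torus.\<close>

lemma inj_on_ends: "inj_on (ends G) (edges G)"
proof (rule inj_onI)
  fix f g assume fg: "f \<in> edges G" "g \<in> edges G" "ends G f = ends G g"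
  obtain p i where f: "f = (p, i)" "p \<in> cells a c" "i < length (etypes T)"
    using fg(1) unfolding torus_lattice_def by auto
  obtain k d l where e: "etypes T ! i = (k, d, l)" by (cases "etypes T ! i")
  have k: "k < nloc T" using etypes_nth_wf[OF f(3) e] by simp
  have v: "place p ((0, 0), k) \<in> ends G f"
    using f e red_cells unfolding torus_lattice_def place_def by simp
  obtain o1 i1 d1 l1 where 1: "((o1, i1), (d1, l1)) \<in> set (star T k)" "f = place p (o1, i1)"
    using incident_star[OF fg(1) v] by blast
  obtain o2 i2 d2 l2 where 2: "((o2, i2), (d2, l2)) \<in> set (star T k)" "g = place p (o2, i2)"
    using incident_star[OF fg(2)] v fg(3) by metis
  have "place p (d1, l1) = place p (d2, l2)"
    using fg(3) ends_place_star[OF 1(1), of p] ends_place_star[OF 2(1), of p] 1(2) 2(2)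
    by (auto simp: doubleton_eq_iff)
  moreover have "distinct (map (place p) (map snd (star T k)))"
    using star_okI[OF k] sorted_apart_distinct unfolding star_ok_def by blast
  then have "inj_on (\<lambda>t. place p (snd t)) (set (star T k))" by (simp add: distinct_map comp_def)
  ultimately have "((o1, i1), (d1, l1)) = ((o2, i2), (d2, l2))"
    using inj_onD[of "\<lambda>t. place p (snd t)" "set (star T k)" "((o1, i1), (d1, l1))" "((o2, i2), (d2, l2))"]
      1(1) 2(1) by simp
  then show "f = g" using 1 2 by simp
qed

sublocale cubic_cell_graph G
proof
  have "edges G = cells a c \<times> {..<length (etypes T)}" unfolding torus_lattice_def by auto
  moreover have "cells a c = {0..<a} \<times> {0..<c}" unfolding cells_def by auto
  ultimately show "finite (edges G)" by simp
next
  fix f assume "f \<in> edges G"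
  then obtain p i where f: "f = (p, i)" "p \<in> cells a c" "i < length (etypes T)"
    unfolding torus_lattice_def by auto
  obtain k d l where e: "etypes T ! i = (k, d, l)" by (cases "etypes T ! i")
  have "(p, k) \<in> verts G" "(rd (cadd p d), l) \<in> verts G" "k \<noteq> l"
    using etypes_nth_wf[OF f(3) e] f unfolding torus_lattice_def by auto
  moreover have "ends G f = {(p, k), (rd (cadd p d), l)}"
    using f e unfolding torus_lattice_def by simp
  ultimately show "\<exists>x\<in>verts G. \<exists>y\<in>verts G. x \<noteq> y \<and> ends G f = {x, y}" by blast
next
  show "inj_on (ends G) (edges G)" by (rule inj_on_ends)
next
  fix S assume "S \<in> faces G"
  then obtain q j where S: "S = face_set T a b c q j" "j < length (ftypes T)"
    unfolding torus_lattice_def by auto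
  show "S \<subseteq> edges G"
  proof
    fix f assume "f \<in> S"
    then obtain off i where "(off, i) \<in> set (ftypes T ! j)" "f = place q (off, i)"
      unfolding S(1) face_set_place by auto
    then show "f \<in> edges G" using ftypes_wf[of "ftypes T ! j" T off i] S(2) place_in_edges by simp
  qed
next
  show "\<exists>e1 e2 e3 F12 F13 F23. is_corner G v e1 e2 e3 F12 F13 F23" if "v \<in> verts G" for v
    using corner_torus[OF that] .
qed

lemma no_triangle:
  assumes "cc_adj G y x" "cc_adj G y z"
  shows "\<not> cc_adj G x z"
proof -
  have "y \<in> verts G" using assms(1) unfolding cc_adj_def by blast
  then obtain q k where y: "y = place q ((0, 0), k)" and k: "k < nloc T" using verts_place by blast
  obtain r s where r: "r \<in> set (nbrs_of T ((0, 0), k))" "x = place q r"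
    and s: "s \<in> set (nbrs_of T ((0, 0), k))" "z = place q s"
    using assms k unfolding y by (auto simp: cc_adj_place)
  show ?thesis
  proof (cases "r = s")
    case True
    then show ?thesis using r s cc_adj_irrefl by simp
  next
    case False
    then have "nonadj T r s" using triangle_okI[OF k] r s unfolding triangle_ok_def by blast
    then show ?thesis using nonadj_place nbrs_of_wf[OF r(1)] r(2) s(2) by blast
  qed
qed

text \<open>All positions refer to one base cell \<open>q\<close>. Hence different vertices have
  different positions, and the plane checks apply to pairs that no lifted step joins.\<close>

lemma lift_neighbourhood:
  assumes "cc_adj G u w" "cc_adj G u x" "cc_adj G u x'" "cc_adj G w y" "cc_adj G w y'"
  obtains q k rw rx rx' ry ry' where "k < nloc T" "u = place q ((0, 0), k)"
    "rw \<in> set (nbrs_of T ((0, 0), k))" "w = place q rw"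
    "rx \<in> set (nbrs_of T ((0, 0), k))" "x = place q rx"
    "rx' \<in> set (nbrs_of T ((0, 0), k))" "x' = place q rx'"
    "ry \<in> set (nbrs_of T rw)" "y = place q ry" "ry' \<in> set (nbrs_of T rw)" "y' = place q ry'"
proof -
  have "u \<in> verts G" using assms(1) unfolding cc_adj_def by blast
  then obtain q k where u: "u = place q ((0, 0), k)" and k: "k < nloc T" using verts_place by blast
  have k': "snd ((0, 0), k) < nloc T" using k by simp
  obtain rw where w: "rw \<in> set (nbrs_of T ((0, 0), k))" "w = place q rw"
    using assms(1) unfolding u cc_adj_place[OF k'] by blast
  obtain rx where x: "rx \<in> set (nbrs_of T ((0, 0), k))" "x = place q rx"
    using assms(2) unfolding u cc_adj_place[OF k'] by blast
  obtain rx' where x': "rx' \<in> set (nbrs_of T ((0, 0), k))" "x' = place q rx'"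
    using assms(3) unfolding u cc_adj_place[OF k'] by blast
  obtain ry where y: "ry \<in> set (nbrs_of T rw)" "y = place q ry"
    using assms(4) unfolding w(2) cc_adj_place[OF nbrs_of_wf[OF w(1)]] by blast
  obtain ry' where y': "ry' \<in> set (nbrs_of T rw)" "y' = place q ry'"
    using assms(5) unfolding w(2) cc_adj_place[OF nbrs_of_wf[OF w(1)]] by blast
  show thesis by (rule that[OF k u w x x' y y'])
qed

lemma no_two_squares:
  assumes adj: "cc_adj G u w" "cc_adj G u x" "cc_adj G u x'" "cc_adj G w y" "cc_adj G w y'"
    and dist: "distinct [u, w, x, x', y, y']" and sq: "cc_adj G x y" "cc_adj G x' y'"
  shows False
  using adj
proof (rule lift_neighbourhood)
  fix q k rw rx rx' ry ry'
  assume k: "k < nloc T" and u: "u = place q ((0, 0), k)"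
    and w: "rw \<in> set (nbrs_of T ((0, 0), k))" "w = place q rw"
    and x: "rx \<in> set (nbrs_of T ((0, 0), k))" "x = place q rx"
    and x': "rx' \<in> set (nbrs_of T ((0, 0), k))" "x' = place q rx'"
    and y: "ry \<in> set (nbrs_of T rw)" "y = place q ry" and y': "ry' \<in> set (nbrs_of T rw)" "y' = place q ry'"
  have "rx \<noteq> rx'" "rx \<noteq> rw" "rx' \<noteq> rw" "ry \<noteq> ry'" "ry \<noteq> ((0, 0), k)" "ry' \<noteq> ((0, 0), k)"
    using dist u w(2) x(2) x'(2) y(2) y'(2) by auto
  then have "nonadj T rx ry \<or> nonadj T rx' ry'"
    using squares_okI[OF k] w(1) x(1) x'(1) y(1) y'(1) unfolding squares_ok_def Let_def by blast
  then show False
    using nonadj_place nbrs_of_wf[OF x(1)] nbrs_of_wf[OF x'(1)] sq x(2) x'(2) y(2) y'(2) by blast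
qed

text \<open>The hexagon is lifted as the walk from \<open>w\<close> over \<open>y'\<close> and
  \<open>t\<close> to \<open>s\<close>, together with \<open>x'\<close> as a lifted neighbour of
  \<open>u\<close>. Only the closing pair \<open>s\<close>, \<open>x'\<close>, like
  \<open>x\<close>, \<open>y\<close> for the square, has to be decided by
  \<open>nonadj\<close>.\<close>

lemma no_square_and_hexagon:
  assumes T: "T \<noteq> Tiling_4612"
    and adj: "cc_adj G u w" "cc_adj G u x" "cc_adj G u x'" "cc_adj G w y" "cc_adj G w y'"
    and dist: "distinct [u, w, x, x', y, y']" and sq: "cc_adj G x y"
    and hex: "cc_adj G x' s" "cc_adj G y' t" "cc_adj G s t"
    and st: "{s, t} \<inter> {u, w, x, x', y, y'} = {}"
  shows False
  using adj
proof (rule lift_neighbourhood)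
  fix q k rw rx rx' ry ry'
  assume k: "k < nloc T" and u: "u = place q ((0, 0), k)"
    and w: "rw \<in> set (nbrs_of T ((0, 0), k))" "w = place q rw"
    and x: "rx \<in> set (nbrs_of T ((0, 0), k))" "x = place q rx"
    and x': "rx' \<in> set (nbrs_of T ((0, 0), k))" "x' = place q rx'"
    and y: "ry \<in> set (nbrs_of T rw)" "y = place q ry" and y': "ry' \<in> set (nbrs_of T rw)" "y' = place q ry'"
  have ne: "rx \<noteq> rx'" "rx \<noteq> rw" "rx' \<noteq> rw" "ry \<noteq> ry'" "ry \<noteq> ((0, 0), k)" "ry' \<noteq> ((0, 0), k)"
    using dist u w(2) x(2) x'(2) y(2) y'(2) by auto
  obtain rt where t: "rt \<in> set (nbrs_of T ry')" "t = place q rt"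
    using hex(2) unfolding y'(2) cc_adj_place[OF nbrs_of_wf[OF y'(1)]] by blast
  obtain rs where s: "rs \<in> set (nbrs_of T rt)" "s = place q rs"
    using cc_adj_sym[OF hex(3)] unfolding t(2) cc_adj_place[OF nbrs_of_wf[OF t(1)]] by blast
  have ne2: "rt \<noteq> rw" "rt \<noteq> rx" "rt \<noteq> rx'" "rs \<noteq> ry" "rs \<noteq> ry'"
    using st w(2) x(2) x'(2) y(2) y'(2) s(2) t(2) by auto
  have "\<not> nonadj T rx ry" using nonadj_place nbrs_of_wf[OF x(1)] sq x(2) y(2) by blast
  then have "nonadj T rs rx'"
    using hexagons_okI[OF T k] w(1) x(1) x'(1) y(1) y'(1) t(1) s(1) ne ne2
    unfolding hexagons_ok_def Let_def by blast
  then show False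
    using nonadj_place nbrs_of_wf[OF s(1)] cc_adj_sym[OF hex(1)] s(2) x'(2) by blast
qed

lemma card_face_honeycomb:
  assumes "T = Honeycomb" "S \<in> faces G"
  shows "card S = 6"
proof -
  obtain q where S: "S = place q ` set (ftypes T ! 0)"
    using assms unfolding faces_torus face_set_place by auto
  have "distinct (map (place q) (ftypes T ! 0))"
    using sorted_apart_distinct honeycomb_face_ok assms(1) by blast
  then have "card (set (map (place q) (ftypes T ! 0))) = length (map (place q) (ftypes T ! 0))"
    by (rule distinct_card)
  then show ?thesis using S assms(1) by simp
qed

lemma removed_competitor:
  fixes H :: "('d, lvert) cmap"
  assumes H: "toroidal_cc_map H" and uw: "cc_adj G u w"
    and labels: "vlabel H ` darts H = verts G - {u, w}"
    and HG: "\<forall>d\<in>darts H. cc_adj G (vlabel H d) (vlabel H (alpha H d))"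
  shows "removed G (map_adj H) \<ge> (if T = Tiling_4612 then 6 else 7)"
proof -
  have "\<exists>x1 x2 y1 y2.
      defect_matching (cc_adj G) (map_adj H) (\<lambda>v z. mult H v z = 2) u w x1 x2 y1 y2"
  proof (rule competitor_defect_matching[OF H uw labels HG])
    show "cc_adj G y x \<Longrightarrow> cc_adj G y z \<Longrightarrow> \<not> cc_adj G x z" for x y z by (rule no_triangle)
    show False if "distinct [u, w, x, x', y, y']" "cc_adj G u x" "cc_adj G u x'" "cc_adj G w y"
      "cc_adj G w y'" "cc_adj G x y" "cc_adj G x' y'" for x x' y y'
      using no_two_squares[OF uw that(2-5,1,6,7)] .
  qed
  then obtain x1 x2 y1 y2 where
    m: "defect_matching (cc_adj G) (map_adj H) (\<lambda>v z. mult H v z = 2) u w x1 x2 y1 y2"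
    by blast
  interpret defect_matching "cc_adj G" "map_adj H" "\<lambda>v z. mult H v z = 2" u w x1 x2 y1 y2
    by (rule m)
  have eq: "removed G (map_adj H) = card lost" unfolding removed_def lost_def ..
  show ?thesis
  proof (cases "T = Tiling_4612")
    case True
    then show ?thesis using eq card_lost_ge_6 by simp
  next
    case False
    have "card lost \<ge> 7"
    proof (rule card_lost_ge_7)
      fix x x' y y' p q
      assume x: "{x, x'} = {x1, x2}" and y: "{y, y'} = {y1, y2}"
        and adj: "cc_adj G x y" "cc_adj G x' p" "cc_adj G y' q" "cc_adj G p q"
        and new: "{p, q} \<inter> {u, w, x1, x2, y1, y2} = {}"
      have "cc_adj G u x" "cc_adj G u x'" "cc_adj G w y" "cc_adj G w y'"
        using x y nbrs by (auto simp: doubleton_eq_iff)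
      moreover have "distinct [u, w, x, x', y, y']"
        using x y dist by (auto simp: doubleton_eq_iff)
      moreover have "{p, q} \<inter> {u, w, x, x', y, y'} = {}"
        using new x y by (auto simp: doubleton_eq_iff)
      ultimately show False by (rule no_square_and_hexagon[OF False uw _ _ _ _ _ adj])
    qed
    then show ?thesis using eq False by simp
  qed
qed

end

theorem theorem2:
  fixes T :: tiling and a b c :: int and col :: "ledge set \<Rightarrow> colour"
    and u w :: lvert and e :: ledge
  assumes torus: "a > 0" "c > 0"
    and large: "\<forall>vs es. is_cycle (torus_lattice T a b c) vs es \<and> \<not> contractible T a b c vs es
                  \<longrightarrow> length es > 8"
    and colouring: "cc_colouring (torus_lattice T a b c) col"
    and u: "u \<in> verts (torus_lattice T a b c)"
    and e: "e \<in> edges (torus_lattice T a b c)" "ends (torus_lattice T a b c) e = {u, w}"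
    and e_type:
      "T = Tiling_488 \<longrightarrow> (\<exists>S1 S2. faces_at (torus_lattice T a b c) e = {S1, S2}
                                  \<and> card S1 = 4 \<and> card S2 = 8)"
      "T = Tiling_4612 \<longrightarrow> (\<exists>S1 S2. faces_at (torus_lattice T a b c) e = {S1, S2}
                                  \<and> card S1 = 4 \<and> card S2 = 6)"
  shows "(let G = torus_lattice T a b c; G' = fst (super_plaquette G col u e) in
           (\<forall>x\<in>edges G'. \<exists>f\<in>edges G. ends G' x = ends G f) \<and>
           removed G (cc_adj G') = (if T = Tiling_4612 then 6 else 7) \<and>
           (\<forall>H :: ('d, lvert) cmap. \<forall>w'.
              toroidal_cc_map H \<and> cc_adj G u w' \<and> vlabel H ` darts H = verts G - {u, w'} \<and>
              (\<forall>d\<in>darts H. cc_adj G (vlabel H d) (vlabel H (alpha H d)))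
              \<longrightarrow> removed G (cc_adj G') \<le> removed G (map_adj H)))"
proof -
  interpret large_torus T a b c
    by unfold_locales (use torus large in auto)
  interpret super_plaquette_input G col u w e
    by unfold_locales (use colouring e in auto)
  \<comment> \<open>The totals are 6 + 6, 4 + 8 and 4 + 6; one more than half of each is 7, 7 and
    6.\<close>
  have "\<exists>S1 S2. faces_at G e = {S1, S2} \<and> S1 \<noteq> S2 \<and>
      card S1 + card S2 = (if T = Tiling_4612 then 10 else 12)"
  proof (cases T)
    case Honeycomb
    obtain S1 S2 where S: "faces_at G e = {S1, S2}" "S1 \<noteq> S2"
      using faces_at_cases[OF colouring e(1)] by metis
    then have "S1 \<in> faces G" "S2 \<in> faces G" unfolding faces_at_def by auto
    then have "card S1 = 6" "card S2 = 6" using card_face_honeycomb[OF Honeycomb] by blast+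
    then show ?thesis using S Honeycomb by (intro exI[of _ S1] exI[of _ S2]) simp
  next
    case Tiling_488
    then obtain S1 S2 where "faces_at G e = {S1, S2}" "card S1 = 4" "card S2 = 8"
      using e_type(1) by blast
    \<comment> \<open>The two faces are different because their sizes are.\<close>
    then show ?thesis using Tiling_488 by (intro exI[of _ S1] exI[of _ S2]) auto
  next
    case Tiling_4612
    then obtain S1 S2 where "faces_at G e = {S1, S2}" "card S1 = 4" "card S2 = 6"
      using e_type(2) by blast
    then show ?thesis using Tiling_4612 by (intro exI[of _ S1] exI[of _ S2]) auto
  qed
  then obtain S1 S2 where "faces_at G e = {S1, S2}" "S1 \<noteq> S2"
    and S: "card S1 + card S2 = (if T = Tiling_4612 then 10 else 12)" by blast
  then have "2 * card lost_edges = 2 + (card S1 + card S2)" using card_lost_edges by simp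
  then have count: "removed G (cc_adj result) = (if T = Tiling_4612 then 6 else 7)"
    unfolding removed_result S by (simp split: if_splits)
  show ?thesis
    unfolding Let_def count
  proof (intro conjI ballI allI impI refl)
    show "\<exists>f\<in>edges G. ends result x = ends G f" if "x \<in> edges result" for x
      using ends_result that by blast
    \<comment> \<open>The bound holds for every deleted neighbour \<open>w'\<close>, whatever faces
      the edge to it borders, so \<open>w'\<close> need not be the end \<open>w\<close> of
      \<open>e\<close>.\<close>
    show "(if T = Tiling_4612 then 6 else 7) \<le> removed G (map_adj H)"
      if "toroidal_cc_map H \<and> cc_adj G u w' \<and> vlabel H ` darts H = verts G - {u, w'} \<and>
        (\<forall>d\<in>darts H. cc_adj G (vlabel H d) (vlabel H (alpha H d)))"
      for H :: "('d, lvert) cmap" and w'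
      using that by (elim conjE) (rule removed_competitor)
  qed
qed

end
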